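(* Let $s,n\geq 1$ be integers, let $K_n$ be the complete graph on $n$ vertices, and let $H=K_{1,s}$ be the star graph. Then $\operatorname{reg} I_{K_n\to H}=sn-s+1$.
   Context: The star graph $K_{1,s}$ is the undirected graph on $[s+1]=\{1,\dots,s+1\}$ with edge set $\{\{i,s+1\}: i=1,\dots,s\}$. For finite simple undirected graphs $G$ on $[n]$ and $H$ on $[m]$, a weak homomorphism from $G$ to $H$ is a map $\phi:V(G)\to V(H)$ such that for every $\{x,y\}\in E(G)$ either $\phi(x)=\phi(y)$ or $\{\phi(x),\phi(y)\}\in E(H)$; the set of these is $\mathrm{WHom}(G,H)$. Let $K$ be a field and $S=K[x_{ij}: i\in[n], j\in[m]]$. For $\phi\in\mathrm{WHom}(G,H)$ put $u_\phi=\prod_{i=1}^n x_{i\phi(i)}$, and $I_{G\to H}=(u_\phi:\phi\in\mathrm{WHom}(G,H))\subseteq S$. $\operatorname{reg}$ denotes Castelnuovo–Mumford regularity of the ideal as a graded $S$-module: $\operatorname{reg} I=\max\{j-i:\beta_{i,j}(I)\neq0\}$. *)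

theory Defs
  imports Complex_Main "HOL-Library.FuncSet" "HOL-Library.Poly_Mapping"
begin

text \<open>A pair \<open>(n, E)\<close> is the undirected graph with vertex set \<open>{1..n}\<close> and edge set \<open>E\<close>.\<close>

type_synonym ugraph = "nat \<times> nat set set"

abbreviation verts :: "ugraph \<Rightarrow> nat set" where
  "verts G \<equiv> {1..fst G}"

abbreviation edges :: "ugraph \<Rightarrow> nat set set" where
  "edges G \<equiv> snd G"

definition complete_graph :: "nat \<Rightarrow> ugraph" where
  "complete_graph n = (n, {{x, y} |x y. x \<in> {1..n} \<and> y \<in> {1..n} \<and> x \<noteq> y})"

definition star_graph :: "nat \<Rightarrow> ugraph" where
  "star_graph s = (s + 1, {{i, s + 1} |i. i \<in> {1..s}})"

definition WHom :: "ugraph \<Rightarrow> ugraph \<Rightarrow> (nat \<Rightarrow> nat) set" where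
  "WHom G H = {\<phi> \<in> verts G \<rightarrow>\<^sub>E verts H.
     \<forall>x y. {x, y} \<in> edges G \<longrightarrow> \<phi> x = \<phi> y \<or> {\<phi> x, \<phi> y} \<in> edges H}"


text \<open>Polynomials are finitely supported functions from exponent vectors to coefficients. The
  variables may come from an infinite type, so the polynomial ring in the variables \<open>V\<close>
  is the subring \<open>poly_ring V\<close>.\<close>

type_synonym ('v, 'k) mpoly = "('v \<Rightarrow>\<^sub>0 nat) \<Rightarrow>\<^sub>0 'k"

definition poly_ring :: "'v set \<Rightarrow> ('v, 'k::field) mpoly set" where
  "poly_ring V = {p. \<forall>m \<in> Poly_Mapping.keys p. Poly_Mapping.keys m \<subseteq> V}"

definition pvar :: "'v \<Rightarrow> ('v, 'k::field) mpoly" where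
  "pvar v = Poly_Mapping.single (Poly_Mapping.single v 1) 1"

definition mon_deg :: "('v \<Rightarrow>\<^sub>0 nat) \<Rightarrow> nat" where
  "mon_deg m = (\<Sum>v \<in> Poly_Mapping.keys m. Poly_Mapping.lookup m v)"

definition ideal_gen :: "'v set \<Rightarrow> ('v, 'k::field) mpoly set \<Rightarrow> ('v, 'k) mpoly set" where
  "ideal_gen V B = {\<Sum>b\<in>A. c b * b |A c. finite A \<and> A \<subseteq> B \<and> (\<forall>b\<in>A. c b \<in> poly_ring V)}"

definition whom_monomial :: "ugraph \<Rightarrow> (nat \<Rightarrow> nat) \<Rightarrow> (nat \<times> nat, 'k::field) mpoly" where
  "whom_monomial G \<phi> = (\<Prod>i \<in> verts G. pvar (i, \<phi> i))"

abbreviation whom_vars :: "ugraph \<Rightarrow> ugraph \<Rightarrow> (nat \<times> nat) set" where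
  "whom_vars G H \<equiv> verts G \<times> verts H"

definition whom_ideal :: "ugraph \<Rightarrow> ugraph \<Rightarrow> (nat \<times> nat, 'k::field) mpoly set" where
  "whom_ideal G H = ideal_gen (whom_vars G H) (whom_monomial G ` WHom G H)"


text \<open>Elements of the free module \<open>S\<^sup>r\<close> over \<open>S = poly_ring V\<close> are sequences that vanish from
  index \<open>r\<close> on.\<close>

definition free_mod :: "'v set \<Rightarrow> nat \<Rightarrow> (nat \<Rightarrow> ('v, 'k::field) mpoly) set" where
  "free_mod V r = {f. (\<forall>k<r. f k \<in> poly_ring V) \<and> (\<forall>k\<ge>r. f k = 0)}"

text \<open>A sequence of graded free modules \<open>F\<^sub>i = \<Oplus>\<^bsub>k < frank i\<^esub> S(- fshift i k)\<close> with an
  augmentation \<open>F\<^sub>0 \<rightarrow> S\<close> sending the \<open>k\<close>-th basis element to \<open>augm k\<close> and maps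
  \<open>F\<^bsub>i+1\<^esub> \<rightarrow> F\<^sub>i\<close> given by the matrices \<open>dmat i\<close>. Matrix entries with row or column
  index outside the ranks are irrelevant. The shifts are natural numbers, since only ideals of
  \<open>S\<close>, which live in nonnegative degrees, are resolved.\<close>

record (overloaded) ('v, 'k) free_cplx =
  frank :: "nat \<Rightarrow> nat"
  fshift :: "nat \<Rightarrow> nat \<Rightarrow> nat"
  augm :: "nat \<Rightarrow> ('v, 'k) mpoly"
  dmat :: "nat \<Rightarrow> nat \<Rightarrow> nat \<Rightarrow> ('v, 'k) mpoly"

definition augm_map ::
  "('v, 'k::field) free_cplx \<Rightarrow> (nat \<Rightarrow> ('v, 'k) mpoly) \<Rightarrow> ('v, 'k) mpoly" where
  "augm_map F f = (\<Sum>k < frank F 0. augm F k * f k)"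

definition diff_map ::
  "('v, 'k::field) free_cplx \<Rightarrow> nat \<Rightarrow> (nat \<Rightarrow> ('v, 'k) mpoly) \<Rightarrow> (nat \<Rightarrow> ('v, 'k) mpoly)" where
  "diff_map F i f =
     (\<lambda>k. if k < frank F i then \<Sum>l < frank F (Suc i). dmat F i k l * f l else 0)"

text \<open>All maps have degree \<open>0\<close>: \<open>augm F k\<close> is homogeneous of degree \<open>fshift F 0 k\<close> and the entry
  \<open>dmat F i k l\<close> is homogeneous of degree \<open>fshift F (i+1) l - fshift F i k\<close> (hence \<open>0\<close> if this
  difference is negative).\<close>

definition graded_cplx :: "'v set \<Rightarrow> ('v, 'k::field) free_cplx \<Rightarrow> bool" where
  "graded_cplx V F \<longleftrightarrow>
     (\<forall>k < frank F 0. augm F k \<in> poly_ring V \<and>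
        (\<forall>m \<in> Poly_Mapping.keys (augm F k). mon_deg m = fshift F 0 k)) \<and>
     (\<forall>i. \<forall>k < frank F i. \<forall>l < frank F (Suc i). dmat F i k l \<in> poly_ring V \<and>
        (\<forall>m \<in> Poly_Mapping.keys (dmat F i k l). mon_deg m + fshift F i k = fshift F (Suc i) l))"

definition graded_free_resolution ::
  "'v set \<Rightarrow> ('v, 'k::field) mpoly set \<Rightarrow> ('v, 'k) free_cplx \<Rightarrow> bool" where
  "graded_free_resolution V I F \<longleftrightarrow> graded_cplx V F \<and>
     augm_map F ` free_mod V (frank F 0) = I \<and>
     {f \<in> free_mod V (frank F 0). augm_map F f = 0} = diff_map F 0 ` free_mod V (frank F 1) \<and>
     (\<forall>i. {f \<in> free_mod V (frank F (Suc i)). diff_map F i f = (\<lambda>_. 0)} =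
            diff_map F (Suc i) ` free_mod V (frank F (Suc (Suc i))))"

text \<open>Minimality means that \<open>F\<^bsub>i+1\<^esub>\<close> is mapped into \<open>\<mm> F\<^sub>i\<close> for the irrelevant ideal \<open>\<mm>\<close>,
  i.e. that all matrix entries have zero constant coefficient.\<close>

definition minimal_graded_free_resolution ::
  "'v set \<Rightarrow> ('v, 'k::field) mpoly set \<Rightarrow> ('v, 'k) free_cplx \<Rightarrow> bool" where
  "minimal_graded_free_resolution V I F \<longleftrightarrow> graded_free_resolution V I F \<and>
     (\<forall>i. \<forall>k < frank F i. \<forall>l < frank F (Suc i). Poly_Mapping.lookup (dmat F i k l) 0 = 0)"

text \<open>\<open>\<beta>\<^bsub>i,j\<^esub>(I)\<close> is the multiplicity of \<open>S(-j)\<close> in \<open>F\<^sub>i\<close>. For \<open>V\<close> finite and \<open>I\<close> a homogeneous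
  ideal, a minimal graded free resolution \<open>F\<close> exists and is unique up to isomorphism, so that the
  number does not depend on the choice.\<close>

definition betti :: "'v set \<Rightarrow> ('v, 'k::field) mpoly set \<Rightarrow> nat \<Rightarrow> nat \<Rightarrow> nat" where
  "betti V I i j =
     (let F = (SOME F. minimal_graded_free_resolution V I F)
      in card {k. k < frank F i \<and> fshift F i k = j})"

text \<open>\<open>GREATEST\<close> is the maximum of a set of integers; unlike \<open>Max\<close> it does not presuppose that
  the set is finite.\<close>

definition reg :: "'v set \<Rightarrow> ('v, 'k::field) mpoly set \<Rightarrow> int" where
  "reg V I = (GREATEST d. \<exists>i j. betti V I i j \<noteq> 0 \<and> d = int j - int i)"

end

theory Submission
  imports Defs "HOL-Library.Function_Algebras"
begin

text \<open>Write \<open>y\<^sub>i\<close> for the variable of the pair of \<open>i\<close> and the centre. The generators are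
  \<open>\<Prod>\<^bsub>i\<in>A\<^esub> x\<^bsub>ij\<^esub> \<Prod>\<^bsub>i\<notin>A\<^esub> y\<^sub>i\<close> for a leaf \<open>j\<close> and a set \<open>A\<close> of vertices. If they are added by increasing \<open>|A|\<close>
  and then by increasing \<open>j\<close>, every colon ideal is the complete intersection of the variables \<open>y\<^sub>i\<close>
  for \<open>i \<in> A\<close> and the monomials \<open>\<Prod>\<^bsub>i\<in>A\<^esub> x\<^bsub>ip\<^esub>\<close> for \<open>p < j\<close>. The iterated mapping cone of the Koszul complexes can
  be made explicit: besides one generator for \<open>A = \<emptyset>\<close> it has basis elements \<open>(A, P, T)\<close> for nonempty
  \<open>A\<close>, a nonempty set \<open>P\<close> of leaves and \<open>T \<subseteq> A\<close>, in homological degree \<open>|P| + |T| - 1\<close> and multidegree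
  \<open>\<Prod>\<^bsub>i\<in>A,p\<in>P\<^esub> x\<^bsub>ip\<^esub> \<Prod>\<^bsub>i\<in>(-A)\<union>T\<^esub> y\<^sub>i\<close>. The multidegrees are pairwise distinct, so this resolution is minimal, and the
  difference of degree and homological degree is \<open>n + (|A| - 1)(|P| - 1)\<close>, which is maximal for
  \<open>|A| = n\<close> and \<open>|P| = s\<close>. The same shifts occur in every minimal resolution because homotopy
  equivalences between minimal resolutions are invertible modulo the irrelevant ideal.\<close>

section \<open>Polynomials and their components\<close>

text \<open>The cone construction only suggests the complex; exactness is proved independently of
  it. In a fixed multidegree \<open>m\<close> it is linear algebra over the field on the cells whose
  label divides \<open>m\<close>, and since labels are squarefree only the set \<open>M\<close> of
  variables of \<open>m\<close> matters. Such a subcomplex is contracted by cones: apexes t with y_t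
  in \<open>M\<close> remove all cells except those with one fixed A and with T = {}, and these are
  contracted by an apex among the leaves. The differential encodes y_x u_{A,j} = x_{xj} u_{A-x,j}
  for x in A: an index x is removed from T alone or from both T and A. The irregular spot is A = {},
  where the generator does not depend on j. The pairs ({}, {q}) that the uniform rule would give are
  merged into one cell, so its row of the differential needs separate treatment. Since
  \<open>betti\<close> picks a resolution by \<open>SOME\<close>, the explicit one has to be
  compared with an unknown one. Only the sets of shifts are compared, not multiplicities: the
  regularity asks merely which Betti numbers are nonzero.\<close>

lemma poly_mapping_sum_singles:
  fixes p :: "'a \<Rightarrow>\<^sub>0 'b::comm_monoid_add"
  shows "p = (\<Sum>m\<in>Poly_Mapping.keys p. Poly_Mapping.single m (Poly_Mapping.lookup p m))"
proof (rule poly_mapping_eqI)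
  fix k
  have "(\<Sum>m\<in>Poly_Mapping.keys p. Poly_Mapping.lookup p m when m = k) = Poly_Mapping.lookup p k"
    by (cases "k \<in> Poly_Mapping.keys p")
      (auto simp: when_def in_keys_iff sum.delta' cong: if_cong)
  then show "Poly_Mapping.lookup p k = Poly_Mapping.lookup
      (\<Sum>m\<in>Poly_Mapping.keys p. Poly_Mapping.single m (Poly_Mapping.lookup p m)) k"
    by (simp add: lookup_sum lookup_single)
qed

lemma lookup_single_times:
  fixes p :: "'a::cancel_comm_monoid_add \<Rightarrow>\<^sub>0 'b::comm_semiring_0"
  shows "Poly_Mapping.lookup (Poly_Mapping.single u c * p) w =
    (\<Sum>m\<in>Poly_Mapping.keys p. c * Poly_Mapping.lookup p m when u + m = w)"
proof -
  have "Poly_Mapping.single u c * p =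
      (\<Sum>m\<in>Poly_Mapping.keys p. Poly_Mapping.single (u + m) (c * Poly_Mapping.lookup p m))"
    by (subst (1) poly_mapping_sum_singles[of p]) (simp add: sum_distrib_left mult_single)
  then show ?thesis
    by (simp add: lookup_sum lookup_single)
qed

lemma lookup_single_times_add:
  fixes p :: "'a::cancel_comm_monoid_add \<Rightarrow>\<^sub>0 'b::comm_semiring_0"
  shows "Poly_Mapping.lookup (Poly_Mapping.single u c * p) (u + w) = c * Poly_Mapping.lookup p w"
  by (cases "w \<in> Poly_Mapping.keys p")
    (auto simp: lookup_single_times when_def in_keys_iff sum.delta' cong: if_cong)

lemma lookup_single_times_eq_0:
  fixes p :: "'a::cancel_comm_monoid_add \<Rightarrow>\<^sub>0 'b::comm_semiring_0"
  assumes "\<And>m. w \<noteq> u + m"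
  shows "Poly_Mapping.lookup (Poly_Mapping.single u c * p) w = 0"
  by (simp add: lookup_single_times when_def assms[symmetric])

lemma poly_times_sum_singles:
  fixes p q :: "'a::comm_monoid_add \<Rightarrow>\<^sub>0 'b::comm_semiring_0"
  shows "p * q = (\<Sum>m\<in>Poly_Mapping.keys p. \<Sum>m'\<in>Poly_Mapping.keys q.
    Poly_Mapping.single (m + m') (Poly_Mapping.lookup p m * Poly_Mapping.lookup q m'))"
  by (subst (1) poly_mapping_sum_singles[of p], subst (1) poly_mapping_sum_singles[of q])
    (simp add: sum_distrib_left sum_distrib_right mult_single, rule sum.swap)

lemma exponent_add_eq_0_iff:
  fixes m m' :: "'v \<Rightarrow>\<^sub>0 nat"
  shows "m + m' = 0 \<longleftrightarrow> m = 0 \<and> m' = 0"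
  by (auto simp: poly_mapping_eq_iff lookup_add fun_eq_iff)

text \<open>Natural exponents add up to 0 only if both are 0. Reduction modulo the irrelevant ideal
  is thus a ring homomorphism to the field, which is how minimality is exploited later.\<close>

lemma const_coeff_times:
  fixes p q :: "('v, 'k::field) mpoly"
  shows "Poly_Mapping.lookup (p * q) 0 = Poly_Mapping.lookup p 0 * Poly_Mapping.lookup q 0"
proof -
  have "Poly_Mapping.lookup (p * q) 0 = (\<Sum>m\<in>Poly_Mapping.keys p. \<Sum>m'\<in>Poly_Mapping.keys q.
      if m = 0 \<and> m' = 0 then Poly_Mapping.lookup p m * Poly_Mapping.lookup q m' else 0)"
    unfolding poly_times_sum_singles[of p q]
    by (auto simp: lookup_sum lookup_single when_def exponent_add_eq_0_iff intro!: sum.cong)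
  also have "\<dots> = (\<Sum>m\<in>Poly_Mapping.keys p. if m = 0 then \<Sum>m'\<in>Poly_Mapping.keys q.
      if m' = 0 then Poly_Mapping.lookup p m * Poly_Mapping.lookup q m' else 0 else 0)"
    by (intro sum.cong refl) auto
  also have "\<dots> = Poly_Mapping.lookup p 0 * Poly_Mapping.lookup q 0"
    by (simp add: in_keys_iff)
  finally show ?thesis .
qed

lemma mon_deg_superset:
  assumes "finite A" "Poly_Mapping.keys m \<subseteq> A"
  shows "mon_deg m = (\<Sum>v\<in>A. Poly_Mapping.lookup m v)"
  unfolding mon_deg_def using assms by (intro sum.mono_neutral_left) (auto simp: in_keys_iff)

lemma mon_deg_add: "mon_deg (m + m') = mon_deg m + mon_deg m'"
proof -
  let ?A = "Poly_Mapping.keys m \<union> Poly_Mapping.keys m'"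
  have "mon_deg (m + m') = (\<Sum>v\<in>?A. Poly_Mapping.lookup (m + m') v)"
    by (intro mon_deg_superset keys_add) simp
  also have "\<dots> = (\<Sum>v\<in>?A. Poly_Mapping.lookup m v) + (\<Sum>v\<in>?A. Poly_Mapping.lookup m' v)"
    by (simp add: lookup_add sum.distrib)
  also have "\<dots> = mon_deg m + mon_deg m'"
    by (simp add: mon_deg_superset[symmetric])
  finally show ?thesis .
qed

section \<open>Closure properties of the polynomial subring\<close>

lemma poly_ring_0 [simp]: "0 \<in> poly_ring V"
  by (simp add: poly_ring_def)

lemma poly_ring_1 [simp]: "1 \<in> poly_ring V"
  by (simp add: poly_ring_def)

lemma poly_ring_add: "p \<in> poly_ring V \<Longrightarrow> q \<in> poly_ring V \<Longrightarrow> p + q \<in> poly_ring V"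
  unfolding poly_ring_def using keys_add[of p q] by blast

lemma poly_ring_uminus: "p \<in> poly_ring V \<Longrightarrow> - p \<in> poly_ring V"
  unfolding poly_ring_def by (simp add: in_keys_iff)

lemma poly_ring_diff: "p \<in> poly_ring V \<Longrightarrow> q \<in> poly_ring V \<Longrightarrow> p - q \<in> poly_ring V"
  using poly_ring_add[of p V "- q"] poly_ring_uminus[of q V] by simp

lemma poly_ring_times:
  assumes "p \<in> poly_ring V" "q \<in> poly_ring V" shows "p * q \<in> poly_ring V"
proof -
  have "Poly_Mapping.keys m \<subseteq> V" if m: "m \<in> Poly_Mapping.keys (p * q)" for m
  proof -
    obtain a b where "m = a + b" "a \<in> Poly_Mapping.keys p" "b \<in> Poly_Mapping.keys q"
      using keys_mult[of p q] m by blast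
    then show ?thesis
      using assms keys_add[of a b] unfolding poly_ring_def by blast
  qed
  then show ?thesis by (simp add: poly_ring_def)
qed

lemma poly_ring_sum: "(\<And>x. x \<in> A \<Longrightarrow> f x \<in> poly_ring V) \<Longrightarrow> sum f A \<in> poly_ring V"
  by (induction A rule: infinite_finite_induct) (auto intro: poly_ring_add)

text \<open>With a degree condition as \<open>P\<close> this is a homogeneous component.\<close>

definition part :: "('a \<Rightarrow> bool) \<Rightarrow> ('a \<Rightarrow>\<^sub>0 'b::zero) \<Rightarrow> ('a \<Rightarrow>\<^sub>0 'b)" where
  "part P p = Poly_Mapping.mapp (\<lambda>m c. c when P m) p"

lemma lookup_part: "Poly_Mapping.lookup (part P p) m = (Poly_Mapping.lookup p m when P m)"
  by (auto simp: part_def lookup_mapp when_def in_keys_iff)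

lemma part_sum:
  fixes f :: "'x \<Rightarrow> 'a \<Rightarrow>\<^sub>0 'b::comm_monoid_add"
  shows "part P (sum f A) = (\<Sum>x\<in>A. part P (f x))"
  by (rule poly_mapping_eqI) (simp add: lookup_part lookup_sum when_def)

lemma keys_part: "Poly_Mapping.keys (part P p) = {m \<in> Poly_Mapping.keys p. P m}"
  by (auto simp: in_keys_iff lookup_part)

lemma part_single: "part P (Poly_Mapping.single m c) = (Poly_Mapping.single m c when P m)"
  by (rule poly_mapping_eqI) (auto simp: lookup_part lookup_single when_def)

text \<open>The case in mind is a homogeneous \<open>p\<close>: it shifts all degrees by the same
  amount, so taking components commutes with multiplication up to that shift.\<close>

lemma part_times:
  fixes p q :: "('v, 'k::field) mpoly"
  assumes "\<And>m m'. m \<in> Poly_Mapping.keys p \<Longrightarrow> m' \<in> Poly_Mapping.keys q \<Longrightarrow> P (m + m') \<longleftrightarrow> Q m'"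
  shows "part P (p * q) = p * part Q q"
proof -
  have "p * part Q q = p * (\<Sum>m'\<in>Poly_Mapping.keys q.
      part Q (Poly_Mapping.single m' (Poly_Mapping.lookup q m')))"
    by (subst (1) poly_mapping_sum_singles[of q]) (simp add: part_sum)
  also have "\<dots> = (\<Sum>m\<in>Poly_Mapping.keys p. \<Sum>m'\<in>Poly_Mapping.keys q.
      Poly_Mapping.single m (Poly_Mapping.lookup p m) *
        part Q (Poly_Mapping.single m' (Poly_Mapping.lookup q m')))"
    by (subst (1) poly_mapping_sum_singles[of p])
      (simp add: sum_distrib_left sum_distrib_right, rule sum.swap)
  also have "\<dots> = part P (p * q)"
    unfolding poly_times_sum_singles[of p q] part_sum
    by (intro sum.cong) (auto simp: part_single mult_single when_def assms)
  finally show ?thesis by simp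
qed

section \<open>Comparison of graded free resolutions\<close>

definition mat_mult :: "nat \<Rightarrow> (nat \<Rightarrow> nat \<Rightarrow> 'a::comm_ring_1) \<Rightarrow> (nat \<Rightarrow> nat \<Rightarrow> 'a) \<Rightarrow> nat \<Rightarrow> nat \<Rightarrow> 'a" where
  "mat_mult r A B = (\<lambda>i j. \<Sum>k<r. A i k * B k j)"

definition id_mat :: "nat \<Rightarrow> nat \<Rightarrow> nat \<Rightarrow> 'a::comm_ring_1" where
  "id_mat r = (\<lambda>i j. if i = j \<and> i < r then 1 else 0)"

lemma mat_mult_assoc: "mat_mult r (mat_mult q A B) C = mat_mult q A (mat_mult r B C)"
  unfolding mat_mult_def sum_distrib_left sum_distrib_right
  by (intro ext, subst sum.swap) (simp add: mult.assoc)

lemma mat_mult_diff_left: "mat_mult r (A - B) C = mat_mult r A C - mat_mult r B C"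
  by (simp add: mat_mult_def fun_eq_iff left_diff_distrib sum_subtractf)

lemma mat_mult_diff_right: "mat_mult r A (B - C) = mat_mult r A B - mat_mult r A C"
  by (simp add: mat_mult_def fun_eq_iff right_diff_distrib sum_subtractf)

lemma mat_mult_0_left [simp]: "mat_mult r 0 A = 0"
  by (simp add: mat_mult_def fun_eq_iff)

lemma mat_mult_0_right [simp]: "mat_mult r A 0 = 0"
  by (simp add: mat_mult_def fun_eq_iff)

lemma mat_mult_id_mat_left:
  assumes "\<And>k l. k \<ge> r \<Longrightarrow> A k l = 0"
  shows "mat_mult r (id_mat r) A = A"
proof (intro ext)
  fix i j
  have "mat_mult r (id_mat r) A i j = (\<Sum>k<r. if k = i then A i j else 0)"
    unfolding mat_mult_def id_mat_def by (intro sum.cong) auto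
  then show "mat_mult r (id_mat r) A i j = A i j"
    using assms by simp
qed

lemma mat_mult_id_mat_right:
  assumes "\<And>k l. l \<ge> r \<Longrightarrow> A k l = 0"
  shows "mat_mult r A (id_mat r) = A"
proof (intro ext)
  fix i j
  have "mat_mult r A (id_mat r) i j = (\<Sum>k<r. if k = j then A i j else 0)"
    unfolding mat_mult_def id_mat_def by (intro sum.cong) auto
  then show "mat_mult r A (id_mat r) i j = A i j"
    using assms by simp
qed

definition ring_mat :: "'v set \<Rightarrow> (nat \<Rightarrow> nat \<Rightarrow> ('v, 'k::field) mpoly) \<Rightarrow> bool" where
  "ring_mat V A \<longleftrightarrow> (\<forall>i j. A i j \<in> poly_ring V)"

lemma ring_mat_mult: "ring_mat V A \<Longrightarrow> ring_mat V B \<Longrightarrow> ring_mat V (mat_mult r A B)"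
  by (auto simp: ring_mat_def mat_mult_def intro!: poly_ring_sum poly_ring_times)

lemma ring_mat_diff: "ring_mat V A \<Longrightarrow> ring_mat V B \<Longrightarrow> ring_mat V (A - B)"
  by (auto simp: ring_mat_def intro!: poly_ring_diff)

lemma ring_mat_id_mat: "ring_mat V (id_mat r)"
  by (auto simp: ring_mat_def id_mat_def)

text \<open>Together with \<open>ring_mat\<close> this makes every column an element of
  \<open>free_mod V r\<close>.\<close>

definition rows0 :: "nat \<Rightarrow> (nat \<Rightarrow> nat \<Rightarrow> 'a::zero) \<Rightarrow> bool" where
  "rows0 r A \<longleftrightarrow> (\<forall>k\<ge>r. \<forall>l. A k l = 0)"

lemma rows0_mat_mult: "rows0 r A \<Longrightarrow> rows0 r (mat_mult q A B)"
  by (simp add: rows0_def mat_mult_def)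

lemma rows0_diff: "rows0 r A \<Longrightarrow> rows0 r B \<Longrightarrow> rows0 r (A - (B :: nat \<Rightarrow> nat \<Rightarrow> 'a::comm_ring_1))"
  by (simp add: rows0_def)

lemma rows0_id_mat: "rows0 r (id_mat r)"
  by (simp add: rows0_def id_mat_def)

text \<open>The augmented complex \<open>\<dots> \<rightarrow> F\<^sub>1 \<rightarrow> F\<^sub>0 \<rightarrow> S\<close> with all modules shifted by one position, so that the
  augmentation is the zeroth map; matrices are truncated by \<open>0\<close> so that matrix identities
  become identities of functions.\<close>

definition xrank :: "('v, 'k) free_cplx \<Rightarrow> nat \<Rightarrow> nat" where
  "xrank F i = (case i of 0 \<Rightarrow> 1 | Suc j \<Rightarrow> frank F j)"

definition xshift :: "('v, 'k) free_cplx \<Rightarrow> nat \<Rightarrow> nat \<Rightarrow> nat" where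
  "xshift F i k = (case i of 0 \<Rightarrow> 0 | Suc j \<Rightarrow> fshift F j k)"

definition xmat :: "('v, 'k::field) free_cplx \<Rightarrow> nat \<Rightarrow> nat \<Rightarrow> nat \<Rightarrow> ('v, 'k) mpoly" where
  "xmat F i k l = (if k < xrank F i \<and> l < xrank F (Suc i)
     then (case i of 0 \<Rightarrow> augm F l | Suc j \<Rightarrow> dmat F j k l) else 0)"

definition vapp :: "nat \<Rightarrow> (nat \<Rightarrow> nat \<Rightarrow> 'a::comm_ring_1) \<Rightarrow> (nat \<Rightarrow> 'a) \<Rightarrow> nat \<Rightarrow> 'a" where
  "vapp r A f = (\<lambda>k. \<Sum>l<r. A k l * f l)"

lemma xrank_simps [simp]: "xrank F 0 = 1" "xrank F (Suc i) = frank F i"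
  by (simp_all add: xrank_def)

lemma xshift_simps [simp]: "xshift F 0 k = 0" "xshift F (Suc i) k = fshift F i k"
  by (simp_all add: xshift_def)

lemma diff_map_eq_vapp: "diff_map F i f = vapp (xrank F (Suc (Suc i))) (xmat F (Suc i)) f"
  by (auto simp: diff_map_def vapp_def xmat_def fun_eq_iff)

lemma vapp_xmat_0: "vapp (xrank F (Suc 0)) (xmat F 0) f = (\<lambda>k. if k = 0 then augm_map F f else 0)"
  by (auto simp: augm_map_def vapp_def xmat_def fun_eq_iff)

lemma graded_cplx_iff: "graded_cplx V F \<longleftrightarrow>
    (\<forall>i k l. xmat F i k l \<in> poly_ring V \<and>
      (\<forall>m \<in> Poly_Mapping.keys (xmat F i k l). mon_deg m + xshift F i k = xshift F (Suc i) l))"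
  (is "?L \<longleftrightarrow> ?R")
proof
  assume L: ?L
  show ?R
  proof (intro allI)
    fix i k l
    show "xmat F i k l \<in> poly_ring V \<and>
      (\<forall>m \<in> Poly_Mapping.keys (xmat F i k l). mon_deg m + xshift F i k = xshift F (Suc i) l)"
      using L by (cases i) (auto simp: graded_cplx_def xmat_def)
  qed
next
  assume R: ?R
  have "augm F l \<in> poly_ring V \<and> (\<forall>m \<in> Poly_Mapping.keys (augm F l). mon_deg m = fshift F 0 l)"
    if "l < frank F 0" for l
    using R[rule_format, of 0 0 l] that by (auto simp: xmat_def)
  moreover have "dmat F i k l \<in> poly_ring V \<and>
      (\<forall>m \<in> Poly_Mapping.keys (dmat F i k l). mon_deg m + fshift F i k = fshift F (Suc i) l)"
    if "k < frank F i" "l < frank F (Suc i)" for i k l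
    using R[rule_format, of "Suc i" k l] that by (auto simp: xmat_def)
  ultimately show ?L unfolding graded_cplx_def by blast
qed

text \<open>With the ring at position 0, exactness at F_0 and at the later modules becomes one
  statement for all \<open>i\<close>. At the ring itself the image \<open>I\<close> takes the place
  of exactness.\<close>

lemma graded_free_resolution_iff: "graded_free_resolution V I F \<longleftrightarrow> graded_cplx V F \<and>
    augm_map F ` free_mod V (frank F 0) = I \<and>
    (\<forall>i. {f \<in> free_mod V (xrank F (Suc i)). vapp (xrank F (Suc i)) (xmat F i) f = 0} =
       vapp (xrank F (Suc (Suc i))) (xmat F (Suc i)) ` free_mod V (xrank F (Suc (Suc i))))"
  (is "_ \<longleftrightarrow> _ \<and> _ \<and> (\<forall>i. ?E i)")
proof -
  have split: "(\<forall>i. P i) \<longleftrightarrow> P 0 \<and> (\<forall>i. P (Suc i))" for P :: "nat \<Rightarrow> bool"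
    by (metis not0_implies_Suc)
  have d: "diff_map F i = vapp (xrank F (Suc (Suc i))) (xmat F (Suc i))" for i
    by (rule ext) (rule diff_map_eq_vapp)
  have a: "vapp (xrank F (Suc 0)) (xmat F 0) f = 0 \<longleftrightarrow> augm_map F f = 0" for f
    unfolding vapp_xmat_0 by (auto simp: fun_eq_iff)
  have 1: "?E 0 \<longleftrightarrow>
    {f \<in> free_mod V (frank F 0). augm_map F f = 0} = diff_map F 0 ` free_mod V (frank F 1)"
    unfolding a d by simp
  have 2: "?E (Suc i) \<longleftrightarrow> {f \<in> free_mod V (frank F (Suc i)). diff_map F i f = (\<lambda>_. 0)} =
            diff_map F (Suc i) ` free_mod V (frank F (Suc (Suc i)))" for i
    unfolding d by (simp add: zero_fun_def)
  show ?thesis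
    unfolding graded_free_resolution_def split[of ?E] 1 2 ..
qed

lemma mat_mult_eq_vapp: "mat_mult r A B k l = vapp r A (\<lambda>j. B j l) k"
  by (simp add: vapp_def mat_mult_def)

context
  fixes V :: "'v set" and I :: "('v, 'k::field) mpoly set" and F :: "('v, 'k) free_cplx"
  assumes res: "graded_free_resolution V I F"
begin

lemma xmat_graded: "xmat F i k l \<in> poly_ring V \<and>
    (\<forall>m \<in> Poly_Mapping.keys (xmat F i k l). mon_deg m + xshift F i k = xshift F (Suc i) l)"
  by (rule res[unfolded graded_free_resolution_iff, THEN conjunct1, unfolded graded_cplx_iff,
        THEN spec, THEN spec, THEN spec])

lemma xmat_ring: "ring_mat V (xmat F i)"
  using xmat_graded by (simp add: ring_mat_def)

lemma xmat_deg:
  "m \<in> Poly_Mapping.keys (xmat F i k l) \<Longrightarrow> mon_deg m + xshift F i k = xshift F (Suc i) l"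
  using xmat_graded by simp

lemma xmat_cols0: "l \<ge> xrank F (Suc i) \<Longrightarrow> xmat F i k l = 0"
  by (simp add: xmat_def)

lemma xmat_exact: "{f \<in> free_mod V (xrank F (Suc i)). vapp (xrank F (Suc i)) (xmat F i) f = 0} =
    vapp (xrank F (Suc (Suc i))) (xmat F (Suc i)) ` free_mod V (xrank F (Suc (Suc i)))"
  by (rule res[unfolded graded_free_resolution_iff, THEN conjunct2, THEN conjunct2, THEN spec])

text \<open>Each column of the second matrix is the image of a unit vector, and exactness puts
  images into the kernel.\<close>

lemma xmat_complex: "mat_mult (xrank F (Suc i)) (xmat F i) (xmat F (Suc i)) = 0"
proof -
  let ?r = "xrank F (Suc (Suc i))"
  have "mat_mult (xrank F (Suc i)) (xmat F i) (xmat F (Suc i)) k l = 0" for k l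
  proof (cases "l < ?r")
    case True
    have "(\<lambda>j. id_mat ?r j l :: ('v, 'k) mpoly) \<in> free_mod V ?r"
      using ring_mat_id_mat[of V ?r] rows0_id_mat[of ?r]
      by (auto simp: free_mod_def ring_mat_def rows0_def)
    then have "vapp ?r (xmat F (Suc i)) (\<lambda>j. id_mat ?r j l) \<in>
        {f \<in> free_mod V (xrank F (Suc i)). vapp (xrank F (Suc i)) (xmat F i) f = 0}"
      unfolding xmat_exact by (rule imageI)
    moreover have "mat_mult ?r (xmat F (Suc i)) (id_mat ?r) = xmat F (Suc i)"
      by (rule mat_mult_id_mat_right) (rule xmat_cols0)
    then have "vapp ?r (xmat F (Suc i)) (\<lambda>j. id_mat ?r j l) = (\<lambda>k. xmat F (Suc i) k l)"
      by (simp only: mat_mult_eq_vapp fun_eq_iff) simp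
    ultimately have "vapp (xrank F (Suc i)) (xmat F i) (\<lambda>k. xmat F (Suc i) k l) = 0"
      by simp
    then show ?thesis
      by (simp only: mat_mult_eq_vapp zero_fun_def)
  qed (simp add: mat_mult_def xmat_cols0)
  then show ?thesis by (intro ext) simp
qed

text \<open>Projectivity of free modules: the columns of \<open>N\<close> are cycles and are lifted
  one at a time.\<close>

lemma xmat_lift:
  assumes N: "ring_mat V N" "rows0 (xrank F (Suc i)) N" "mat_mult (xrank F (Suc i)) (xmat F i) N = 0"
  shows "\<exists>W. ring_mat V W \<and> rows0 (xrank F (Suc (Suc i))) W \<and>
    mat_mult (xrank F (Suc (Suc i))) (xmat F (Suc i)) W = N"
proof -
  let ?r = "xrank F (Suc (Suc i))"
  have "\<exists>w. w \<in> free_mod V ?r \<and> vapp ?r (xmat F (Suc i)) w = (\<lambda>k. N k l)" for l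
  proof -
    have "(\<lambda>k. N k l) \<in> free_mod V (xrank F (Suc i))"
      using N by (auto simp: free_mod_def ring_mat_def rows0_def)
    moreover have "vapp (xrank F (Suc i)) (xmat F i) (\<lambda>k. N k l) = 0"
      using N(3) by (simp only: mat_mult_eq_vapp fun_eq_iff) simp
    ultimately have "(\<lambda>k. N k l) \<in> vapp ?r (xmat F (Suc i)) ` free_mod V ?r"
      unfolding xmat_exact[symmetric] by simp
    then show ?thesis by auto
  qed
  then obtain w where w: "\<And>l. w l \<in> free_mod V ?r"
    "\<And>l. vapp ?r (xmat F (Suc i)) (w l) = (\<lambda>k. N k l)"
    by metis
  have "ring_mat V (\<lambda>k l. w l k)" "rows0 ?r (\<lambda>k l. w l k)"
    using w(1) unfolding free_mod_def ring_mat_def rows0_def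
    by (auto, metis linorder_not_less poly_ring_0)
  moreover have "mat_mult ?r (xmat F (Suc i)) (\<lambda>k l. w l k) = N"
    using w(2) by (simp add: mat_mult_def vapp_def fun_eq_iff)
  ultimately show ?thesis by blast
qed

end

section \<open>Chain maps, homotopies and shifts of minimal resolutions\<close>

lemma augmentation_lift:
  assumes F: "graded_free_resolution V I F" and G: "graded_free_resolution V I G"
  shows "\<exists>W. ring_mat V W \<and> rows0 (xrank G (Suc 0)) W \<and>
    mat_mult (xrank G (Suc 0)) (xmat G 0) W = xmat F 0"
proof -
  let ?r = "xrank G (Suc 0)"
  have "\<exists>w. w \<in> free_mod V ?r \<and> vapp ?r (xmat G 0) w = (\<lambda>k. xmat F 0 k l)" for l
  proof -
    let ?e = "\<lambda>j. id_mat (frank F 0) j l"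
    have "?e \<in> free_mod V (frank F 0)"
      using ring_mat_id_mat[of V "frank F 0"] rows0_id_mat[of "frank F 0"]
      by (auto simp: free_mod_def ring_mat_def rows0_def)
    \<comment> \<open>The first lift rests on both augmentations having the image \<open>I\<close>;
      exactness is available only from F_0 on.\<close>
    then have "augm_map F ?e \<in> I"
      using F unfolding graded_free_resolution_def by blast
    then obtain w where w: "w \<in> free_mod V ?r" "augm_map G w = augm_map F ?e"
      using G unfolding graded_free_resolution_def by fastforce
    have "vapp ?r (xmat G 0) w = vapp (xrank F (Suc 0)) (xmat F 0) ?e"
      unfolding vapp_xmat_0 w(2) ..
    also have "\<dots> = (\<lambda>k. xmat F 0 k l)"
      using mat_mult_id_mat_right[of "frank F 0" "xmat F 0"]
      by (simp only: mat_mult_eq_vapp fun_eq_iff) (simp add: xmat_def)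
    finally show ?thesis using w(1) by blast
  qed
  then obtain w where w: "\<And>l. w l \<in> free_mod V ?r"
    "\<And>l. vapp ?r (xmat G 0) (w l) = (\<lambda>k. xmat F 0 k l)"
    by metis
  have "ring_mat V (\<lambda>k l. w l k)" "rows0 ?r (\<lambda>k l. w l k)"
    using w(1) unfolding free_mod_def ring_mat_def rows0_def
    by (auto, metis linorder_not_less poly_ring_0)
  moreover have "mat_mult ?r (xmat G 0) (\<lambda>k l. w l k) = xmat F 0"
    using w(2) by (simp add: mat_mult_def vapp_def fun_eq_iff)
  ultimately show ?thesis by blast
qed

text \<open>The identity at position 0 says that the map covers the identity of the ideal. No
  grading is imposed here.\<close>

definition chain_map :: "'v set \<Rightarrow> ('v, 'k::field) free_cplx \<Rightarrow> ('v, 'k) free_cplx \<Rightarrow>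
    (nat \<Rightarrow> nat \<Rightarrow> nat \<Rightarrow> ('v, 'k) mpoly) \<Rightarrow> bool" where
  "chain_map V F G \<alpha> \<longleftrightarrow> \<alpha> 0 = id_mat 1 \<and> (\<forall>i. ring_mat V (\<alpha> i)) \<and> (\<forall>i. rows0 (xrank G i) (\<alpha> i)) \<and>
    (\<forall>i. mat_mult (xrank G (Suc i)) (xmat G i) (\<alpha> (Suc i)) = mat_mult (xrank F i) (\<alpha> i) (xmat F i))"

lemma chain_mapI:
  assumes "\<alpha> 0 = id_mat 1" "\<And>i. ring_mat V (\<alpha> i)" "\<And>i. rows0 (xrank G i) (\<alpha> i)"
    "\<And>i. mat_mult (xrank G (Suc i)) (xmat G i) (\<alpha> (Suc i)) = mat_mult (xrank F i) (\<alpha> i) (xmat F i)"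
  shows "chain_map V F G \<alpha>"
  unfolding chain_map_def by (intro conjI allI assms)

lemma chain_mapD:
  assumes "chain_map V F G \<alpha>"
  shows "\<alpha> 0 = id_mat 1" "ring_mat V (\<alpha> i)" "rows0 (xrank G i) (\<alpha> i)"
    "mat_mult (xrank G (Suc i)) (xmat G i) (\<alpha> (Suc i)) = mat_mult (xrank F i) (\<alpha> i) (xmat F i)"
  using assms by (simp_all only: chain_map_def)

lemma chain_map_exists:
  assumes F: "graded_free_resolution V I F" and G: "graded_free_resolution V I G"
  shows "\<exists>\<alpha>. chain_map V F G \<alpha>"
proof -
  let ?lift = "\<lambda>i a b. ring_mat V b \<and> rows0 (xrank G (Suc i)) b \<and>
    mat_mult (xrank G (Suc i)) (xmat G i) b = mat_mult (xrank F i) a (xmat F i)"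
  \<comment> \<open>Existence of the next matrix is part of the invariant because it comes from
    \<open>augmentation_lift\<close> at the start and from \<open>xmat_lift\<close>
    afterwards.\<close>
  let ?P = "\<lambda>i a. (i = 0 \<longrightarrow> a = id_mat 1) \<and> ring_mat V a \<and> rows0 (xrank G i) a \<and> (\<exists>b. ?lift i a b)"
  have base: "?P 0 (id_mat 1)"
    using augmentation_lift[OF F G]
    by (simp add: ring_mat_id_mat rows0_id_mat[of 1, simplified] mat_mult_id_mat_left[of "Suc 0"] xmat_def)
  have step: "\<exists>b. ?P (Suc i) b \<and> ?lift i a b" if a: "?P i a" for i a
  proof -
    obtain b where b: "?lift i a b" using a by blast
    have "mat_mult (xrank G (Suc i)) (xmat G i) (mat_mult (xrank F (Suc i)) b (xmat F (Suc i))) =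
        mat_mult (xrank F i) a (mat_mult (xrank F (Suc i)) (xmat F i) (xmat F (Suc i)))"
      using b by (simp only: mat_mult_assoc[symmetric])
    then have "mat_mult (xrank G (Suc i)) (xmat G i) (mat_mult (xrank F (Suc i)) b (xmat F (Suc i))) = 0"
      by (simp only: xmat_complex[OF F] mat_mult_0_right)
    then have "\<exists>c. ?lift (Suc i) b c"
      using b by (intro xmat_lift[OF G] ring_mat_mult rows0_mat_mult) (auto intro: xmat_ring[OF F])
    then show ?thesis using b by blast
  qed
  have "\<exists>\<alpha>. \<forall>i. ?P i (\<alpha> i) \<and> ?lift i (\<alpha> i) (\<alpha> (Suc i))"
  proof (rule dependent_nat_choice)
    show "\<exists>a. ?P 0 a"
      using base by (rule exI[of "?P 0"])
    show "\<exists>b. ?P (Suc i) b \<and> ?lift i a b" if "?P i a" for a i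
      using that by (rule step)
  qed
  then obtain \<alpha> where \<alpha>: "\<forall>i. ?P i (\<alpha> i) \<and> ?lift i (\<alpha> i) (\<alpha> (Suc i))"
    by (elim exE)
  have "\<alpha> 0 = id_mat 1"
    using \<alpha>[THEN spec, of 0] by (elim conjE) (rule mp, assumption, rule refl)
  moreover have "ring_mat V (\<alpha> i)" for i
    using \<alpha>[THEN spec, of i] by (elim conjE)
  moreover have "rows0 (xrank G i) (\<alpha> i)" for i
    using \<alpha>[THEN spec, of i] by (elim conjE)
  moreover have "mat_mult (xrank G (Suc i)) (xmat G i) (\<alpha> (Suc i)) = mat_mult (xrank F i) (\<alpha> i) (xmat F i)" for i
    using \<alpha>[THEN spec, of i] by (elim conjE)
  ultimately show ?thesis by (intro exI chain_mapI)
qed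

text \<open>Meant for the difference of two maps that agree at position 0. The matrix
  \<open>h i\<close> leads from position \<open>i\<close> to position \<open>Suc i\<close>.\<close>

lemma homotopy_exists:
  assumes F: "graded_free_resolution V I F"
    and \<gamma>: "\<And>i. ring_mat V (\<gamma> i)" "\<And>i. rows0 (xrank F i) (\<gamma> i)" "\<gamma> 0 = 0"
      "\<And>i. mat_mult (xrank F (Suc i)) (xmat F i) (\<gamma> (Suc i)) = mat_mult (xrank F i) (\<gamma> i) (xmat F i)"
  shows "\<exists>h. h 0 = 0 \<and> (\<forall>i. \<gamma> (Suc i) =
    mat_mult (xrank F (Suc (Suc i))) (xmat F (Suc i)) (h (Suc i)) + mat_mult (xrank F i) (h i) (xmat F i))"
proof -
  let ?P = "\<lambda>i a. (i = 0 \<longrightarrow> a = 0) \<and> ring_mat V a \<and> rows0 (xrank F (Suc i)) a \<and>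
    mat_mult (xrank F (Suc i)) (xmat F i) (mat_mult (xrank F i) a (xmat F i)) = mat_mult (xrank F i) (\<gamma> i) (xmat F i)"
  let ?Q = "\<lambda>i a b. \<gamma> (Suc i) = mat_mult (xrank F (Suc (Suc i))) (xmat F (Suc i)) b
    + mat_mult (xrank F i) a (xmat F i)"
  have base: "?P 0 0"
    by (simp add: \<gamma>(3) ring_mat_def rows0_def)
  have step: "\<exists>b. ?P (Suc i) b \<and> ?Q i a b" if a: "?P i a" for i a
  proof -
    \<comment> \<open>The last clause of \<open>?P\<close> says precisely that the columns of
      \<open>?N\<close> are cycles.\<close>
    let ?N = "\<gamma> (Suc i) - mat_mult (xrank F i) a (xmat F i)"
    have "mat_mult (xrank F (Suc i)) (xmat F i) ?N = 0"
      using a \<gamma>(4)[of i] by (simp add: mat_mult_diff_right)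
    moreover have "ring_mat V ?N" "rows0 (xrank F (Suc i)) ?N"
      using a \<gamma>(1,2) xmat_ring[OF F] by (intro ring_mat_diff ring_mat_mult rows0_diff rows0_mat_mult; blast)+
    ultimately obtain b where b: "ring_mat V b" "rows0 (xrank F (Suc (Suc i))) b"
      "mat_mult (xrank F (Suc (Suc i))) (xmat F (Suc i)) b = ?N"
      using xmat_lift[OF F] by blast
    have "mat_mult (xrank F (Suc (Suc i))) (xmat F (Suc i)) (mat_mult (xrank F (Suc i)) b (xmat F (Suc i))) =
        mat_mult (xrank F (Suc i)) ?N (xmat F (Suc i))"
      by (simp only: mat_mult_assoc[symmetric] b(3))
    also have "\<dots> = mat_mult (xrank F (Suc i)) (\<gamma> (Suc i)) (xmat F (Suc i))"
      by (simp only: mat_mult_diff_left mat_mult_assoc xmat_complex[OF F] mat_mult_0_right diff_zero)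
    finally have "?P (Suc i) b"
      using b(1,2) by simp
    moreover have "?Q i a b"
      unfolding b(3) by simp
    ultimately show ?thesis by blast
  qed
  have "\<exists>h. \<forall>i. ?P i (h i) \<and> ?Q i (h i) (h (Suc i))"
  proof (rule dependent_nat_choice)
    show "\<exists>a. ?P 0 a"
      using base by (rule exI[of "?P 0"])
    show "\<exists>b. ?P (Suc i) b \<and> ?Q i a b" if "?P i a" for a i
      using that by (rule step)
  qed
  then obtain h where h: "\<forall>i. ?P i (h i) \<and> ?Q i (h i) (h (Suc i))"
    by (elim exE)
  have "h 0 = 0"
    using h[THEN spec, of 0] by (elim conjE) (rule mp, assumption, rule refl)
  moreover have "?Q i (h i) (h (Suc i))" for i
    using h[THEN spec, of i] by (elim conjE)
  ultimately show ?thesis by (intro exI[of _ h] conjI allI)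
qed

text \<open>Passing to components of the appropriate degree turns any chain map between the resolutions
  into a homogeneous one; its constant entries then preserve the shifts.\<close>

lemma graded_chain_map_exists:
  assumes F: "graded_free_resolution V I F" and G: "graded_free_resolution V I G"
  shows "\<exists>\<alpha>. chain_map V F G \<alpha> \<and>
    (\<forall>i k l. Poly_Mapping.lookup (\<alpha> i k l) 0 \<noteq> 0 \<longrightarrow> xshift G i k = xshift F i l)"
proof -
  obtain \<alpha> where "chain_map V F G \<alpha>"
    using chain_map_exists[OF F G] by (elim exE)
  note \<alpha> = chain_mapD[OF this]
  \<comment> \<open>The degree that an entry of a degree 0 map must have, written additively to
    avoid subtraction of naturals.\<close>
  define P where "P i k l = (\<lambda>m::'a \<Rightarrow>\<^sub>0 nat. mon_deg m + xshift G i k = xshift F i l)" for i k l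
  define \<beta> where "\<beta> i k l = part (P i k l) (\<alpha> i k l)" for i k l
  have part_1: "part (P 0 k l) 1 = (1 :: ('a, 'b) mpoly)" for k l
    using part_single[of "P 0 k l" 0 "1 :: 'b"] by (simp add: P_def mon_deg_def)
  have part_0: "part R 0 = (0 :: ('a, 'b) mpoly)" for R :: "('a \<Rightarrow>\<^sub>0 nat) \<Rightarrow> bool"
    by (rule poly_mapping_eqI) (simp add: lookup_part)
  have "\<beta> 0 = id_mat 1"
    by (intro ext) (simp add: \<beta>_def \<alpha>(1) id_mat_def part_0 part_1)
  moreover have "ring_mat V (\<beta> i)" for i
    using \<alpha>(2)[of i] by (auto simp: ring_mat_def \<beta>_def poly_ring_def keys_part)
  moreover have "rows0 (xrank G i) (\<beta> i)" for i
    using \<alpha>(3)[of i] by (simp add: rows0_def \<beta>_def part_0)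
  moreover have "mat_mult (xrank G (Suc i)) (xmat G i) (\<beta> (Suc i)) = mat_mult (xrank F i) (\<beta> i) (xmat F i)" for i
  proof (intro ext)
    fix k l
    let ?Q = "\<lambda>m::'a \<Rightarrow>\<^sub>0 nat. mon_deg m + xshift G i k = xshift F (Suc i) l"
    have 1: "part ?Q (xmat G i k j * \<alpha> (Suc i) j l) = xmat G i k j * \<beta> (Suc i) j l" for j
      unfolding \<beta>_def P_def
    proof (rule part_times)
      fix m m' assume "m \<in> Poly_Mapping.keys (xmat G i k j)"
      then have "mon_deg m + xshift G i k = xshift G (Suc i) j"
        by (rule xmat_deg[OF G])
      then show "(mon_deg (m + m') + xshift G i k = xshift F (Suc i) l) =
          (mon_deg m' + xshift G (Suc i) j = xshift F (Suc i) l)"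
        by (auto simp: mon_deg_add)
    qed
    have 2: "part ?Q (xmat F i j l * \<alpha> i k j) = xmat F i j l * \<beta> i k j" for j
      unfolding \<beta>_def P_def
    proof (rule part_times)
      fix m m' assume "m \<in> Poly_Mapping.keys (xmat F i j l)"
      then have "mon_deg m + xshift F i j = xshift F (Suc i) l"
        by (rule xmat_deg[OF F])
      then show "(mon_deg (m + m') + xshift G i k = xshift F (Suc i) l) =
          (mon_deg m' + xshift G i k = xshift F i j)"
        by (auto simp: mon_deg_add)
    qed
    have "mat_mult (xrank G (Suc i)) (xmat G i) (\<beta> (Suc i)) k l =
        part ?Q (mat_mult (xrank G (Suc i)) (xmat G i) (\<alpha> (Suc i)) k l)"
      by (simp only: mat_mult_def part_sum 1)
    also have "\<dots> = part ?Q (mat_mult (xrank F i) (\<alpha> i) (xmat F i) k l)"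
      by (simp only: \<alpha>(4))
    also have "\<dots> = mat_mult (xrank F i) (\<beta> i) (xmat F i) k l"
      by (simp only: mat_mult_def part_sum 2[unfolded mult.commute[of "xmat F i _ _"]])
    finally show "mat_mult (xrank G (Suc i)) (xmat G i) (\<beta> (Suc i)) k l =
      mat_mult (xrank F i) (\<beta> i) (xmat F i) k l" .
  qed
  moreover have "Poly_Mapping.lookup (\<beta> i k l) 0 \<noteq> 0 \<longrightarrow> xshift G i k = xshift F i l" for i k l
    by (auto simp: \<beta>_def lookup_part P_def mon_deg_def when_def split: if_splits)
  ultimately show ?thesis by (intro exI[of _ \<beta>] conjI chain_mapI allI)
qed

lemma const_coeff_mat_mult:
  fixes A B :: "nat \<Rightarrow> nat \<Rightarrow> ('v, 'k::field) mpoly"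
  shows "Poly_Mapping.lookup (mat_mult r A B k l) 0 =
    (\<Sum>j<r. Poly_Mapping.lookup (A k j) 0 * Poly_Mapping.lookup (B j l) 0)"
  by (simp add: mat_mult_def lookup_sum const_coeff_times)

text \<open>The composite of the comparison maps differs from the identity by dh + hd. By minimality
  this has no constant terms, so the constant part of the composite is the identity and column
  \<open>k\<close> of the constant part of \<open>\<alpha>\<close> is nonzero. As
  \<open>\<alpha>\<close> is homogeneous, a nonzero constant entry links equal shifts.\<close>

lemma minimal_resolution_shift:
  assumes F: "minimal_graded_free_resolution V I F" and G: "graded_free_resolution V I G"
    and k: "k < frank F i"
  shows "\<exists>l < frank G i. fshift G i l = fshift F i k"
proof -
  have FR: "graded_free_resolution V I F"
    and min: "\<And>i k l. k < frank F i \<Longrightarrow> l < frank F (Suc i) \<Longrightarrow> Poly_Mapping.lookup (dmat F i k l) 0 = 0"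
    using F by (auto simp: minimal_graded_free_resolution_def)
  obtain \<alpha> where \<alpha>_map: "chain_map V F G \<alpha>" and
    \<alpha>_shift: "\<forall>i k l. Poly_Mapping.lookup (\<alpha> i k l) 0 \<noteq> 0 \<longrightarrow> xshift G i k = xshift F i l"
    using graded_chain_map_exists[OF FR G] by (elim exE conjE)
  obtain \<beta> where \<beta>_map: "chain_map V G F \<beta>"
    using chain_map_exists[OF G FR] by (elim exE)
  note \<alpha> = chain_mapD[OF \<alpha>_map] and \<beta> = chain_mapD[OF \<beta>_map]
  define \<gamma> where "\<gamma> i = mat_mult (xrank G i) (\<beta> i) (\<alpha> i) - id_mat (xrank F i)" for i
  have "\<exists>h. h 0 = 0 \<and> (\<forall>i. \<gamma> (Suc i) =
    mat_mult (xrank F (Suc (Suc i))) (xmat F (Suc i)) (h (Suc i)) + mat_mult (xrank F i) (h i) (xmat F i))"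
  proof (rule homotopy_exists[OF FR, of \<gamma>])
    show "ring_mat V (\<gamma> i)" "rows0 (xrank F i) (\<gamma> i)" for i
      using \<alpha> \<beta> by (auto simp: \<gamma>_def intro!: ring_mat_diff ring_mat_mult ring_mat_id_mat
          rows0_diff rows0_mat_mult rows0_id_mat)
    have "mat_mult 1 (id_mat 1) (id_mat 1) = (id_mat 1 :: nat \<Rightarrow> nat \<Rightarrow> ('a, 'b) mpoly)"
      by (rule mat_mult_id_mat_left) (simp add: id_mat_def)
    then show "\<gamma> 0 = 0"
      by (simp add: \<gamma>_def \<alpha>(1) \<beta>(1))
    show "mat_mult (xrank F (Suc i)) (xmat F i) (\<gamma> (Suc i)) = mat_mult (xrank F i) (\<gamma> i) (xmat F i)" for i
    proof -
      have "mat_mult (xrank F (Suc i)) (xmat F i) (mat_mult (xrank G (Suc i)) (\<beta> (Suc i)) (\<alpha> (Suc i))) =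
          mat_mult (xrank F i) (mat_mult (xrank G i) (\<beta> i) (\<alpha> i)) (xmat F i)"
        by (simp only: mat_mult_assoc[symmetric] \<beta>(4)) (simp only: mat_mult_assoc \<alpha>(4))
      moreover have "mat_mult (xrank F (Suc i)) (xmat F i) (id_mat (xrank F (Suc i))) = xmat F i"
        by (rule mat_mult_id_mat_right) (simp add: xmat_def)
      moreover have "mat_mult (xrank F i) (id_mat (xrank F i)) (xmat F i) = xmat F i"
        by (rule mat_mult_id_mat_left) (simp add: xmat_def)
      ultimately show ?thesis
        by (simp only: \<gamma>_def mat_mult_diff_right mat_mult_diff_left)
    qed
  qed
  then obtain h where h0: "h 0 = 0" and h: "\<forall>i. \<gamma> (Suc i) =
    mat_mult (xrank F (Suc (Suc i))) (xmat F (Suc i)) (h (Suc i)) + mat_mult (xrank F i) (h i) (xmat F i)"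
    by (elim exE conjE)
  have xmin: "Poly_Mapping.lookup (xmat F (Suc i) k l) 0 = 0" for i k l
    using min by (simp add: xmat_def)
  have one: "Poly_Mapping.lookup (id_mat (frank F i) k k :: ('a, 'b) mpoly) 0 = 1"
    using k by (simp add: id_mat_def)
  have "\<exists>j < frank G i. Poly_Mapping.lookup (\<alpha> (Suc i) j k) 0 \<noteq> 0"
  proof (cases "\<exists>j < frank G i. Poly_Mapping.lookup (\<alpha> (Suc i) j k) 0 \<noteq> 0")
    case False
    then have "Poly_Mapping.lookup (\<gamma> (Suc i) k k) 0 = - 1"
      by (simp add: \<gamma>_def lookup_minus const_coeff_mat_mult one)
    \<comment> \<open>Minimality says nothing about the entries of the augmentation, so for
      \<open>i = 0\<close> this term is handled by the vanishing of \<open>h 0\<close>.\<close>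
    moreover have "Poly_Mapping.lookup (mat_mult (xrank F i) (h i) (xmat F i) k k) 0 = 0" 
    proof (cases i)
      case 0
      then show ?thesis by (simp add: h0)
    next
      case (Suc j)
      then show ?thesis by (simp add: const_coeff_mat_mult xmin)
    qed
    ultimately show ?thesis
      by (simp add: h[THEN spec] lookup_add const_coeff_mat_mult[of _ "xmat F (Suc i)"] xmin)
  qed simp
  then obtain j where j: "j < frank G i" "Poly_Mapping.lookup (\<alpha> (Suc i) j k) 0 \<noteq> 0"
    by (elim exE conjE)
  then have "xshift G (Suc i) j = xshift F (Suc i) k"
    by (intro \<alpha>_shift[THEN spec, THEN spec, THEN spec, THEN mp])
  with j(1) show ?thesis by auto
qed

section \<open>Homogenization of labelled complexes\<close>

definition mdvd :: "('v \<Rightarrow>\<^sub>0 nat) \<Rightarrow> ('v \<Rightarrow>\<^sub>0 nat) \<Rightarrow> bool" where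
  "mdvd a b \<longleftrightarrow> (\<exists>u. b = a + u)"

lemma mdvd_trans: "mdvd a b \<Longrightarrow> mdvd b c \<Longrightarrow> mdvd a c"
  by (auto simp: mdvd_def add.assoc)

lemma keys_add_nat:
  fixes a b :: "'v \<Rightarrow>\<^sub>0 nat"
  shows "Poly_Mapping.keys (a + b) = Poly_Mapping.keys a \<union> Poly_Mapping.keys b"
  by (auto simp: in_keys_iff lookup_add)

text \<open>A finite complex of vector spaces with bases \<open>B i\<close> whose basis elements carry monomials \<open>\<mu> b\<close>.
  Multiplying the entry \<open>c a b\<close> by \<open>\<mu> b / \<mu> a\<close> homogenizes it, and the homogenization is a resolution
  as soon as the subcomplexes of elements whose label divides \<open>m\<close> are exact for all \<open>m\<close>. Position \<open>0\<close> is
  occupied by the ring itself.\<close>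

locale labelled_cplx =
  fixes V :: "'v set" and B :: "nat \<Rightarrow> 'b set" and \<mu> :: "'b \<Rightarrow> ('v \<Rightarrow>\<^sub>0 nat)"
    and c :: "'b \<Rightarrow> 'b \<Rightarrow> 'k::field" and r :: 'b
  assumes finite_B: "finite (B i)"
    and B_0: "B 0 = {r}"
    and label_r: "\<mu> r = 0"
    and c_r: "b \<in> B (Suc 0) \<Longrightarrow> c r b = 1"
    and label_keys: "b \<in> B i \<Longrightarrow> Poly_Mapping.keys (\<mu> b) \<subseteq> V"
    and label_inj: "inj_on \<mu> (B (Suc 0))"
    and label_mdvd: "a \<in> B i \<Longrightarrow> b \<in> B (Suc i) \<Longrightarrow> c a b \<noteq> 0 \<Longrightarrow> mdvd (\<mu> a) (\<mu> b)"
    and label_neq: "a \<in> B (Suc i) \<Longrightarrow> b \<in> B (Suc (Suc i)) \<Longrightarrow> c a b \<noteq> 0 \<Longrightarrow> \<mu> a \<noteq> \<mu> b"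
    and complex: "a \<in> B i \<Longrightarrow> b \<in> B (Suc (Suc i)) \<Longrightarrow> (\<Sum>x\<in>B (Suc i). c a x * c x b) = 0"
    and acyclic: "(\<And>b. z b \<noteq> 0 \<Longrightarrow> b \<in> B (Suc i) \<and> mdvd (\<mu> b) m) \<Longrightarrow>
      (\<And>a. a \<in> B i \<Longrightarrow> (\<Sum>b\<in>B (Suc i). c a b * z b) = 0) \<Longrightarrow>
      \<exists>w. (\<forall>b. w b \<noteq> 0 \<longrightarrow> b \<in> B (Suc (Suc i)) \<and> mdvd (\<mu> b) m) \<and>
        (\<forall>a\<in>B (Suc i). z a = (\<Sum>b\<in>B (Suc (Suc i)). c a b * w b))"
begin

text \<open>\<open>free_cplx\<close> indexes bases by initial segments of the naturals; any
  enumeration serves, since only the set of shifts is read off.\<close>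

definition en :: "nat \<Rightarrow> nat \<Rightarrow> 'b" where
  "en i = (SOME e. bij_betw e {..<card (B i)} (B i))"

lemma en_bij: "bij_betw (en i) {..<card (B i)} (B i)"
proof -
  have "\<exists>e. bij_betw e {..<card (B i)} (B i)"
    using ex_bij_betw_nat_finite[OF finite_B[of i]] by (simp add: atLeast0LessThan)
  then show ?thesis
    unfolding en_def by (rule someI_ex)
qed

definition ix :: "nat \<Rightarrow> 'b \<Rightarrow> nat" where
  "ix i = the_inv_into {..<card (B i)} (en i)"

lemma en_mem: "k < card (B i) \<Longrightarrow> en i k \<in> B i"
  by (rule bij_betwE[OF en_bij, THEN bspec]) simp

lemma ix_en: "k < card (B i) \<Longrightarrow> ix i (en i k) = k"
  unfolding ix_def by (rule the_inv_into_f_f[OF bij_betw_imp_inj_on[OF en_bij]]) simp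

lemma en_ix: "b \<in> B i \<Longrightarrow> en i (ix i b) = b"
  unfolding ix_def by (rule f_the_inv_into_f_bij_betw[OF en_bij])

lemma ix_less: "b \<in> B i \<Longrightarrow> ix i b < card (B i)"
  unfolding ix_def using bij_betwE[OF bij_betw_the_inv_into[OF en_bij]] by simp

lemma sum_en: "(\<Sum>k<card (B i). f (en i k)) = (\<Sum>b\<in>B i. f b)"
  by (rule sum.reindex_bij_betw[OF en_bij])

text \<open>Between consecutive positions the truncated difference is a true quotient of monomials
  whenever the coefficient is nonzero, by \<open>label_mdvd\<close>.\<close>

definition entry :: "'b \<Rightarrow> 'b \<Rightarrow> ('v, 'k) mpoly" where
  "entry a b = Poly_Mapping.single (\<mu> b - \<mu> a) (c a b)"

definition homogenization :: "('v, 'k) free_cplx" where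
  "homogenization = \<lparr>frank = \<lambda>i. card (B (Suc i)), fshift = \<lambda>i k. mon_deg (\<mu> (en (Suc i) k)),
    augm = \<lambda>k. entry r (en (Suc 0) k), dmat = \<lambda>i k l. entry (en (Suc i) k) (en (Suc (Suc i)) l)\<rparr>"

lemma xrank_homogenization: "xrank homogenization i = card (B i)"
  by (cases i) (simp_all add: homogenization_def B_0)

lemma xshift_homogenization: "k < card (B i) \<Longrightarrow> xshift homogenization i k = mon_deg (\<mu> (en i k))"
  using en_mem[of k i] by (cases i) (simp_all add: homogenization_def B_0 label_r mon_deg_def)

lemma xmat_homogenization:
  "k < card (B i) \<Longrightarrow> l < card (B (Suc i)) \<Longrightarrow> xmat homogenization i k l = entry (en i k) (en (Suc i) l)"
  using en_mem[of k i] unfolding xmat_def xrank_homogenization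
  by (cases i) (simp_all add: homogenization_def B_0)

lemma vapp_homogenization:
  assumes "k < card (B i)"
  shows "vapp (card (B (Suc i))) (xmat homogenization i) f k =
    (\<Sum>b\<in>B (Suc i). entry (en i k) b * f (ix (Suc i) b))"
proof -
  have "vapp (card (B (Suc i))) (xmat homogenization i) f k =
      (\<Sum>l<card (B (Suc i)). entry (en i k) (en (Suc i) l) * f (ix (Suc i) (en (Suc i) l)))"
    unfolding vapp_def using assms by (intro sum.cong refl) (simp add: xmat_homogenization ix_en)
  also have "\<dots> = (\<Sum>b\<in>B (Suc i). entry (en i k) b * f (ix (Suc i) b))"
    by (rule sum_en)
  finally show ?thesis .
qed

lemma vapp_homogenization_outside:
  "k \<ge> card (B i) \<Longrightarrow> vapp q (xmat homogenization i) f k = 0"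
  by (simp add: vapp_def xmat_def xrank_homogenization)

lemma entry_ring: "a \<in> B i \<Longrightarrow> b \<in> B (Suc i) \<Longrightarrow> entry a b \<in> poly_ring V"
  using label_mdvd[of a i b] label_keys[of b "Suc i"]
  by (cases "c a b = 0") (auto simp: entry_def poly_ring_def mdvd_def keys_add_nat)

lemma entry_deg:
  assumes "a \<in> B i" "b \<in> B (Suc i)" "m \<in> Poly_Mapping.keys (entry a b)"
  shows "mon_deg m + mon_deg (\<mu> a) = mon_deg (\<mu> b)"
proof -
  have "c a b \<noteq> 0" "m = \<mu> b - \<mu> a"
    using assms(3) by (auto simp: entry_def split: if_splits)
  moreover obtain u where "\<mu> b = \<mu> a + u"
    using label_mdvd[OF assms(1,2) \<open>c a b \<noteq> 0\<close>] by (auto simp: mdvd_def)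
  ultimately show ?thesis by (simp add: mon_deg_add)
qed

text \<open>The coefficient in multidegree \<open>m\<close> of \<open>p\<close> times the basis
  element \<open>b\<close>, which itself has multidegree \<open>\<mu> b\<close>.\<close>

definition strand :: "('v, 'k) mpoly \<Rightarrow> 'b \<Rightarrow> ('v \<Rightarrow>\<^sub>0 nat) \<Rightarrow> 'k" where
  "strand p b m = (if mdvd (\<mu> b) m then Poly_Mapping.lookup p (m - \<mu> b) else 0)"

lemma strand_add [simp]: "strand p b (\<mu> b + u) = Poly_Mapping.lookup p u"
  by (auto simp: strand_def mdvd_def)

text \<open>The differential preserves multidegrees and acts on the strand of each multidegree
  through the scalars \<open>c a b\<close>. Polynomial equations therefore split into linear
  equations over the field.\<close>

lemma lookup_entry_times:
  assumes "a \<in> B i" "b \<in> B (Suc i)"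
  shows "Poly_Mapping.lookup (entry a b * p) w = c a b * strand p b (\<mu> a + w)"
proof (cases "c a b = 0")
  case True
  then show ?thesis by (simp add: entry_def)
next
  case False
  then obtain u where u: "\<mu> b = \<mu> a + u"
    using label_mdvd[OF assms] by (auto simp: mdvd_def)
  then have entry: "entry a b = Poly_Mapping.single u (c a b)"
    by (simp add: entry_def)
  show ?thesis
  proof (cases "\<exists>x. w = u + x")
    case True
    then obtain x where x: "w = u + x" by (elim exE)
    then have "\<mu> a + w = \<mu> b + x" by (simp add: u add.assoc)
    then show ?thesis
      by (simp add: entry x lookup_single_times_add)
  next
    case False
    then have "\<not> mdvd (\<mu> b) (\<mu> a + w)"
      by (simp add: mdvd_def u add.assoc)
    then show ?thesis
      using False by (simp add: entry strand_def lookup_single_times_eq_0)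
  qed
qed

text \<open>All nonzero products carry the same monomial, the quotient of the outer labels, so
  \<open>complex\<close> decides the sum.\<close>

lemma entry_complex:
  assumes "a \<in> B i" "b \<in> B (Suc (Suc i))"
  shows "(\<Sum>x\<in>B (Suc i). entry a x * entry x b) = 0"
proof -
  have "entry a x * entry x b = Poly_Mapping.single (\<mu> b - \<mu> a) (c a x * c x b)"
    if x: "x \<in> B (Suc i)" for x
  proof (cases "c a x = 0 \<or> c x b = 0")
    case True
    then show ?thesis by (auto simp: entry_def)
  next
    case False
    then obtain u v where "\<mu> x = \<mu> a + u" "\<mu> b = \<mu> x + v"
      using label_mdvd[OF assms(1) x] label_mdvd[OF x assms(2)] by (auto simp: mdvd_def)
    then show ?thesis by (simp add: entry_def mult_single add.assoc)
  qed
  then have "(\<Sum>x\<in>B (Suc i). entry a x * entry x b) =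
      (\<Sum>x\<in>B (Suc i). Poly_Mapping.single (\<mu> b - \<mu> a) (c a x * c x b))"
    by (intro sum.cong) simp_all
  also have "\<dots> = Poly_Mapping.single (\<mu> b - \<mu> a) (\<Sum>x\<in>B (Suc i). c a x * c x b)"
    by (rule poly_mapping_eqI) (simp add: lookup_sum lookup_single when_def)
  finally show ?thesis
    using complex[OF assms] by simp
qed

text \<open>A cycle is cut into its strands, \<open>acyclic\<close> lifts each of them, and the
  lifts are put together as polynomials.\<close>

lemma homogenization_exact:
  assumes f: "\<And>b. b \<in> B (Suc i) \<Longrightarrow> f b \<in> poly_ring V"
    and cycle: "\<And>a. a \<in> B i \<Longrightarrow> (\<Sum>b\<in>B (Suc i). entry a b * f b) = 0"
  shows "\<exists>g. (\<forall>b. g b \<in> poly_ring V) \<and>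
    (\<forall>a\<in>B (Suc i). f a = (\<Sum>b\<in>B (Suc (Suc i)). entry a b * g b))"
proof -
  \<comment> \<open>The multidegrees in which the cycle has a term. Restricting the lifts to this
    finite set makes \<open>g\<close> finitely supported and keeps its variables in
    \<open>V\<close>.\<close>
  define M where "M = (\<Union>b\<in>B (Suc i). (+) (\<mu> b) ` Poly_Mapping.keys (f b))"
  have fin_M: "finite M"
    by (simp add: M_def finite_B)
  have keys_M: "Poly_Mapping.keys m \<subseteq> V" if "m \<in> M" for m
    using that f label_keys[of _ "Suc i"] by (fastforce simp: M_def keys_add_nat poly_ring_def)
  define z where "z m b = (if b \<in> B (Suc i) then strand (f b) b m else 0)" for m b
  have "\<exists>w. (\<forall>b. w b \<noteq> 0 \<longrightarrow> b \<in> B (Suc (Suc i)) \<and> mdvd (\<mu> b) m) \<and>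
        (\<forall>a\<in>B (Suc i). z m a = (\<Sum>b\<in>B (Suc (Suc i)). c a b * w b))" for m
  proof (rule acyclic)
    show "b \<in> B (Suc i) \<and> mdvd (\<mu> b) m" if "z m b \<noteq> 0" for b
      using that by (auto simp: z_def strand_def split: if_splits)
    show "(\<Sum>b\<in>B (Suc i). c a b * z m b) = 0" if a: "a \<in> B i" for a
    proof (cases "mdvd (\<mu> a) m")
      case True
      then obtain w where w: "m = \<mu> a + w" by (auto simp: mdvd_def)
      have "(\<Sum>b\<in>B (Suc i). c a b * z m b) =
          Poly_Mapping.lookup (\<Sum>b\<in>B (Suc i). entry a b * f b) w"
        using lookup_entry_times[OF a] by (simp add: lookup_sum z_def w)
      then show ?thesis by (simp add: cycle[OF a])
    next
      case False
      have "c a b * z m b = 0" if b: "b \<in> B (Suc i)" for b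
        using label_mdvd[OF a b] mdvd_trans[of "\<mu> a" "\<mu> b" m] False
        by (auto simp: z_def strand_def)
      then show ?thesis by (intro sum.neutral ballI)
    qed
  qed
  then obtain w where supp: "\<And>m b. w m b \<noteq> 0 \<Longrightarrow> b \<in> B (Suc (Suc i)) \<and> mdvd (\<mu> b) m"
    and bdry: "\<And>m a. a \<in> B (Suc i) \<Longrightarrow> z m a = (\<Sum>b\<in>B (Suc (Suc i)). c a b * w m b)"
    by metis
  define U where "U b = (+) (\<mu> b) -` M" for b
  have fin_U: "finite (U b)" for b
    unfolding U_def using fin_M by (rule finite_vimageI) simp
  define g where "g b = (if b \<in> B (Suc (Suc i))
    then \<Sum>u\<in>U b. Poly_Mapping.single u (w (\<mu> b + u) b) else 0)" for b
  have lookup_g: "Poly_Mapping.lookup (g b) u = (if \<mu> b + u \<in> M then w (\<mu> b + u) b else 0)"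
    if "b \<in> B (Suc (Suc i))" for b u
  proof -
    have "Poly_Mapping.lookup (g b) u = (\<Sum>v\<in>U b. if v = u then w (\<mu> b + u) b else 0)"
      using that by (auto simp: g_def lookup_sum lookup_single when_def intro!: sum.cong)
    also have "\<dots> = (if \<mu> b + u \<in> M then w (\<mu> b + u) b else 0)"
      using fin_U[of b] by (simp add: U_def)
    finally show ?thesis .
  qed
  have "g b \<in> poly_ring V" for b
  proof (cases "b \<in> B (Suc (Suc i))")
    case True
    have "Poly_Mapping.keys u \<subseteq> V" if "u \<in> Poly_Mapping.keys (g b)" for u
    proof -
      have "\<mu> b + u \<in> M"
        using that lookup_g[OF True, of u] by (auto simp: in_keys_iff split: if_splits)
      then show ?thesis using keys_M[of "\<mu> b + u"] by (simp add: keys_add_nat)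
    qed
    then show ?thesis by (simp add: poly_ring_def)
  qed (simp add: g_def)
  moreover have "f a = (\<Sum>b\<in>B (Suc (Suc i)). entry a b * g b)" if a: "a \<in> B (Suc i)" for a
  proof (rule poly_mapping_eqI)
    fix v
    have strand_g: "strand (g b) b m = (if m \<in> M then w m b else 0)"
      if "b \<in> B (Suc (Suc i))" for b m
    proof (cases "mdvd (\<mu> b) m")
      case True
      then show ?thesis using lookup_g[OF that] by (auto simp: mdvd_def)
    next
      case False
      then show ?thesis using supp[of m b] by (auto simp: strand_def)
    qed
    have "Poly_Mapping.lookup (\<Sum>b\<in>B (Suc (Suc i)). entry a b * g b) v =
        (if \<mu> a + v \<in> M then z (\<mu> a + v) a else 0)"
      using lookup_entry_times[OF a] by (simp add: lookup_sum strand_g bdry[OF a])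
    moreover have "Poly_Mapping.lookup (f a) v = 0" if "\<mu> a + v \<notin> M"
    proof (rule ccontr)
      assume "Poly_Mapping.lookup (f a) v \<noteq> 0"
      then have "\<mu> a + v \<in> M"
        unfolding M_def using a by (intro UN_I[of a] imageI) (simp_all add: in_keys_iff)
      with that show False by (rule notE)
    qed
    ultimately show "Poly_Mapping.lookup (f a) v =
        Poly_Mapping.lookup (\<Sum>b\<in>B (Suc (Suc i)). entry a b * g b) v"
      using a by (simp add: z_def)
  qed
  ultimately show ?thesis by (intro exI[of _ g]) simp
qed

text \<open>\<open>ideal_gen\<close> indexes coefficients by the generators themselves; injectivity
  of the labels translates this to an indexing by basis elements.\<close>

lemma augm_homogenization_image:
  "augm_map homogenization ` free_mod V (frank homogenization 0) =
    ideal_gen V ((\<lambda>b. Poly_Mapping.single (\<mu> b) 1) ` B (Suc 0))"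
proof -
  let ?g = "\<lambda>b. Poly_Mapping.single (\<mu> b) (1 :: 'k)"
  have inj: "inj_on ?g (B (Suc 0))"
    using label_inj by (auto simp: inj_on_def inj_eq[OF inj_single] dest: arg_cong[of _ _ Poly_Mapping.keys])
  have augm: "augm_map homogenization f = (\<Sum>b\<in>B (Suc 0). ?g b * f (ix (Suc 0) b))" for f
  proof -
    have "augm_map homogenization f = (\<Sum>l<card (B (Suc 0)). entry r (en (Suc 0) l) * f (ix (Suc 0) (en (Suc 0) l)))"
      by (simp add: augm_map_def homogenization_def ix_en)
    also have "\<dots> = (\<Sum>b\<in>B (Suc 0). entry r b * f (ix (Suc 0) b))"
      by (rule sum_en)
    also have "\<dots> = (\<Sum>b\<in>B (Suc 0). ?g b * f (ix (Suc 0) b))"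
      by (intro sum.cong refl) (simp add: entry_def label_r c_r)
    finally show ?thesis .
  qed
  have frank: "frank homogenization 0 = card (B (Suc 0))"
    by (simp add: homogenization_def)
  show ?thesis
  proof (intro subset_antisym subsetI)
    fix p assume "p \<in> augm_map homogenization ` free_mod V (frank homogenization 0)"
    then obtain f where f: "f \<in> free_mod V (card (B (Suc 0)))" "p = augm_map homogenization f"
      unfolding frank by (elim imageE)
    let ?c = "\<lambda>q. f (ix (Suc 0) (the_inv_into (B (Suc 0)) ?g q))"
    have "p = (\<Sum>b\<in>B (Suc 0). ?c (?g b) * ?g b)"
      unfolding f(2) augm by (intro sum.cong refl) (simp only: the_inv_into_f_f[OF inj] mult.commute)
    also have "\<dots> = (\<Sum>q\<in>?g ` B (Suc 0). ?c q * q)"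
      by (simp only: sum.reindex[OF inj] o_def)
    finally have "p = (\<Sum>q\<in>?g ` B (Suc 0). ?c q * q)" .
    moreover have "?c q \<in> poly_ring V" if "q \<in> ?g ` B (Suc 0)" for q
      using that f(1) ix_less[of _ "Suc 0"] by (auto simp: the_inv_into_f_f[OF inj] free_mod_def)
    ultimately show "p \<in> ideal_gen V (?g ` B (Suc 0))"
      unfolding ideal_gen_def using finite_B
      by (intro CollectI exI[of _ "?g ` B (Suc 0)"] exI[of _ ?c]) simp
  next
    fix p assume "p \<in> ideal_gen V (?g ` B (Suc 0))"
    then obtain A d where A: "p = (\<Sum>q\<in>A. d q * q)" "A \<subseteq> ?g ` B (Suc 0)" "\<forall>q\<in>A. d q \<in> poly_ring V"
      unfolding ideal_gen_def by (elim CollectE exE conjE)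
    define f where "f l = (if l < card (B (Suc 0)) \<and> ?g (en (Suc 0) l) \<in> A then d (?g (en (Suc 0) l)) else 0)" for l
    have "f \<in> free_mod V (card (B (Suc 0)))"
      using A(3) by (auto simp: free_mod_def f_def)
    moreover have "augm_map homogenization f = p"
    proof -
      have "augm_map homogenization f = (\<Sum>b\<in>B (Suc 0). if ?g b \<in> A then d (?g b) * ?g b else 0)"
        unfolding augm by (intro sum.cong refl)
          (simp add: f_def ix_less en_ix mult.commute)
      also have "\<dots> = (\<Sum>q\<in>?g ` B (Suc 0). if q \<in> A then d q * q else 0)"
        by (simp only: sum.reindex[OF inj] o_def)
      also have "\<dots> = (\<Sum>q\<in>A. d q * q)"
        using A(2) finite_B by (subst sum.inter_restrict[symmetric]) (auto simp: Int_absorb1)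
      finally show ?thesis using A(1) by simp
    qed
    ultimately show "p \<in> augm_map homogenization ` free_mod V (frank homogenization 0)"
      unfolding frank by (intro image_eqI[of _ _ f]) simp_all
  qed
qed

theorem homogenization_minimal_resolution:
  "minimal_graded_free_resolution V (ideal_gen V ((\<lambda>b. Poly_Mapping.single (\<mu> b) 1) ` B (Suc 0)))
    homogenization"
  unfolding minimal_graded_free_resolution_def graded_free_resolution_iff
proof (intro conjI allI impI)
  show "graded_cplx V homogenization"
    unfolding graded_cplx_iff
  proof (intro allI)
    fix i k l
    show "xmat homogenization i k l \<in> poly_ring V \<and>
      (\<forall>m\<in>Poly_Mapping.keys (xmat homogenization i k l).
        mon_deg m + xshift homogenization i k = xshift homogenization (Suc i) l)"
    proof (cases "k < card (B i) \<and> l < card (B (Suc i))")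
      case True
      then show ?thesis
        using entry_ring[of "en i k" i "en (Suc i) l"] entry_deg[of "en i k" i "en (Suc i) l"]
        by (simp only: xmat_homogenization xshift_homogenization en_mem) simp
    next
      case False
      then have "xmat homogenization i k l = 0"
        by (auto simp only: xmat_def xrank_homogenization if_False)
      then show ?thesis by simp
    qed
  qed
  show "augm_map homogenization ` free_mod V (frank homogenization 0) =
    ideal_gen V ((\<lambda>b. Poly_Mapping.single (\<mu> b) 1) ` B (Suc 0))"
    by (rule augm_homogenization_image)
  fix i
  show "{f \<in> free_mod V (xrank homogenization (Suc i)).
      vapp (xrank homogenization (Suc i)) (xmat homogenization i) f = 0} =
    vapp (xrank homogenization (Suc (Suc i))) (xmat homogenization (Suc i)) `
      free_mod V (xrank homogenization (Suc (Suc i)))"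
    unfolding xrank_homogenization
  proof (intro subset_antisym subsetI)
    fix f assume "f \<in> {f \<in> free_mod V (card (B (Suc i))).
      vapp (card (B (Suc i))) (xmat homogenization i) f = 0}"
    then have f: "f \<in> free_mod V (card (B (Suc i)))"
      "vapp (card (B (Suc i))) (xmat homogenization i) f = 0"
      by simp_all
    have "\<exists>g. (\<forall>b. g b \<in> poly_ring V) \<and>
      (\<forall>a\<in>B (Suc i). f (ix (Suc i) a) = (\<Sum>b\<in>B (Suc (Suc i)). entry a b * g b))"
    proof (rule homogenization_exact)
      show "f (ix (Suc i) b) \<in> poly_ring V" if "b \<in> B (Suc i)" for b
        using f(1) ix_less[OF that] by (simp add: free_mod_def)
      show "(\<Sum>b\<in>B (Suc i). entry a b * f (ix (Suc i) b)) = 0" if "a \<in> B i" for a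
        using vapp_homogenization[OF ix_less[OF that], of f] f(2) by (simp add: en_ix[OF that])
    qed
    then obtain g where g: "\<forall>b. g b \<in> poly_ring V"
      "\<forall>a\<in>B (Suc i). f (ix (Suc i) a) = (\<Sum>b\<in>B (Suc (Suc i)). entry a b * g b)"
      by (elim exE conjE)
    define h where "h k = (if k < card (B (Suc (Suc i))) then g (en (Suc (Suc i)) k) else 0)" for k
    have "h \<in> free_mod V (card (B (Suc (Suc i))))"
      using g(1) by (simp add: free_mod_def h_def)
    moreover have "f = vapp (card (B (Suc (Suc i)))) (xmat homogenization (Suc i)) h"
    proof (rule ext)
      fix k
      show "f k = vapp (card (B (Suc (Suc i)))) (xmat homogenization (Suc i)) h k"
      proof (cases "k < card (B (Suc i))")
        case True
        have "f k = (\<Sum>b\<in>B (Suc (Suc i)). entry (en (Suc i) k) b * g b)"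
          using g(2)[THEN bspec, OF en_mem[OF True]] by (simp add: ix_en[OF True])
        also have "\<dots> = (\<Sum>b\<in>B (Suc (Suc i)). entry (en (Suc i) k) b * h (ix (Suc (Suc i)) b))"
          by (intro sum.cong refl) (simp add: h_def ix_less en_ix)
        finally show ?thesis
          by (simp only: vapp_homogenization[OF True])
      next
        case False
        then show ?thesis
          using f(1) by (simp add: vapp_homogenization_outside free_mod_def)
      qed
    qed
    ultimately show "f \<in> vapp (card (B (Suc (Suc i)))) (xmat homogenization (Suc i)) `
        free_mod V (card (B (Suc (Suc i))))"
      by (intro image_eqI)
  next
    fix f assume "f \<in> vapp (card (B (Suc (Suc i)))) (xmat homogenization (Suc i)) `
        free_mod V (card (B (Suc (Suc i))))"
    then obtain g where g: "g \<in> free_mod V (card (B (Suc (Suc i))))"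
      and f: "f = vapp (card (B (Suc (Suc i)))) (xmat homogenization (Suc i)) g"
      by (elim imageE)
    have fk: "f k = (\<Sum>b\<in>B (Suc (Suc i)). entry (en (Suc i) k) b * g (ix (Suc (Suc i)) b))"
      if "k < card (B (Suc i))" for k
      unfolding f by (rule vapp_homogenization[OF that])
    have "f k \<in> poly_ring V" if "k < card (B (Suc i))" for k
      unfolding fk[OF that] using g ix_less[of _ "Suc (Suc i)"] entry_ring en_mem[OF that]
      by (intro poly_ring_sum poly_ring_times) (auto simp: free_mod_def)
    moreover have "f k = 0" if "k \<ge> card (B (Suc i))" for k
      unfolding f by (rule vapp_homogenization_outside[OF that])
    ultimately have "f \<in> free_mod V (card (B (Suc i)))"
      by (simp add: free_mod_def)
    moreover have "vapp (card (B (Suc i))) (xmat homogenization i) f k = 0" for k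
    proof (cases "k < card (B i)")
      case True
      have "vapp (card (B (Suc i))) (xmat homogenization i) f k =
          (\<Sum>x\<in>B (Suc i). entry (en i k) x * (\<Sum>b\<in>B (Suc (Suc i)). entry x b * g (ix (Suc (Suc i)) b)))"
        unfolding vapp_homogenization[OF True]
        by (intro sum.cong refl) (simp only: fk ix_less en_ix)
      also have "\<dots> = (\<Sum>b\<in>B (Suc (Suc i)). (\<Sum>x\<in>B (Suc i). entry (en i k) x * entry x b) *
          g (ix (Suc (Suc i)) b))"
        unfolding sum_distrib_left sum_distrib_right
        by (subst sum.swap) (simp add: mult.assoc)
      also have "\<dots> = 0"
        by (intro sum.neutral ballI) (simp add: entry_complex[OF en_mem[OF True]])
      finally show ?thesis .
    qed (simp add: vapp_homogenization_outside)
    then have "vapp (card (B (Suc i))) (xmat homogenization i) f = 0"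
      by (intro ext) simp
    ultimately show "f \<in> {f \<in> free_mod V (card (B (Suc i))).
      vapp (card (B (Suc i))) (xmat homogenization i) f = 0}"
      by (intro CollectI conjI)
  qed
next
  fix i k l
  assume "k < frank homogenization i" "l < frank homogenization (Suc i)"
  then have kl: "en (Suc i) k \<in> B (Suc i)" "en (Suc (Suc i)) l \<in> B (Suc (Suc i))"
    by (simp_all add: homogenization_def en_mem)
  have "Poly_Mapping.lookup (entry a b) 0 = 0"
    if ab: "a \<in> B (Suc i)" "b \<in> B (Suc (Suc i))" for a b
  proof (cases "c a b = 0")
    case False
    \<comment> \<open>Distinct labels leave a nontrivial monomial as quotient, so the entry has no
      constant term.\<close>
    then obtain u where "\<mu> b = \<mu> a + u" "u \<noteq> 0"
      using label_mdvd[OF ab False] label_neq[OF ab False] by (auto simp: mdvd_def)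
    then show ?thesis by (simp add: entry_def lookup_single)
  qed (simp add: entry_def)
  then show "Poly_Mapping.lookup (dmat homogenization i k l) 0 = 0"
    using kl by (simp add: homogenization_def)
qed

lemma shifts_homogenization:
  "fshift homogenization i ` {..<frank homogenization i} = (\<lambda>b. mon_deg (\<mu> b)) ` B (Suc i)"
proof -
  have "en (Suc i) ` {..<card (B (Suc i))} = B (Suc i)"
    by (rule bij_betw_imp_surj_on[OF en_bij])
  then have "(\<lambda>b. mon_deg (\<mu> b)) ` B (Suc i) =
      (\<lambda>b. mon_deg (\<mu> b)) ` en (Suc i) ` {..<card (B (Suc i))}"
    by (simp only:)
  also have "\<dots> = fshift homogenization i ` {..<frank homogenization i}"
    by (simp add: homogenization_def image_image)
  finally show ?thesis by (rule sym)
qed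

end

section \<open>The cell complex of the star\<close>

text \<open>Pairs with x < y are cancelled against those with y < x. Deducing that the sum equals
  its own negative would give nothing in characteristic 2.\<close>

lemma sum_antisym_0:
  fixes f :: "nat \<Rightarrow> nat \<Rightarrow> 'k::ab_group_add"
  assumes "finite X" "\<And>x y. x \<in> X \<Longrightarrow> y \<in> X \<Longrightarrow> x \<noteq> y \<Longrightarrow> f x y = - f y x"
  shows "(\<Sum>x\<in>X. \<Sum>y\<in>X - {x}. f x y) = 0"
proof -
  have split: "(\<Sum>y\<in>X - {x}. f x y) = (\<Sum>y\<in>{y \<in> X. y < x}. f x y) + (\<Sum>y\<in>{y \<in> X. x < y}. f x y)" for x
  proof -
    have "X - {x} = {y \<in> X. y < x} \<union> {y \<in> X. x < y}" by auto
    then show ?thesis using assms(1) by (simp add: sum.union_disjoint disjoint_iff)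
  qed
  have "(\<Sum>x\<in>X. \<Sum>y\<in>{y \<in> X. x < y}. f x y) = (\<Sum>y\<in>X. \<Sum>x\<in>{x \<in> X. x < y}. f x y)"
    using sum.swap_restrict[OF assms(1,1), of f "\<lambda>x y. x < y"] by simp
  also have "\<dots> = (\<Sum>y\<in>X. \<Sum>x\<in>{x \<in> X. x < y}. - f y x)"
    by (intro sum.cong refl, rule assms(2)) auto
  finally show ?thesis
    unfolding split sum.distrib by (simp add: sum_negf)
qed

text \<open>The sign that sorts the exterior product of e_x with e_Q.\<close>

definition eps :: "nat \<Rightarrow> nat set \<Rightarrow> 'k::field" where
  "eps x Q = (- 1) ^ card {q \<in> Q. q < x}"

lemma eps_square: "eps x Q * eps x Q = (1 :: 'k::field)"
  by (simp add: eps_def flip: power_mult_distrib)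

lemma eps_insert:
  assumes "finite Q" "x \<notin> Q"
  shows "eps y (insert x Q) = (if x < y then - eps y Q else eps y Q :: 'k::field)"
proof (cases "x < y")
  case True
  have "{q \<in> insert x Q. q < y} = insert x {q \<in> Q. q < y}" using True by auto
  then show ?thesis using assms True by (simp add: eps_def)
next
  case False
  then have "{q \<in> insert x Q. q < y} = {q \<in> Q. q < y}" by auto
  then show ?thesis using False by (simp add: eps_def)
qed

text \<open>Two indices taken in opposite orders: the sign behind d d = 0.\<close>

lemma eps_swap:
  assumes "finite Q" "x \<notin> Q" "y \<notin> Q" "x \<noteq> y"
  shows "eps x Q * eps y (insert x Q) = - (eps y Q * eps x (insert y Q) :: 'k::field)"
  using assms by (auto simp: eps_insert)

text \<open>One index is inserted and the other removed: the sign behind the cancellation in the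
  homotopy formula \<open>koszul_cone\<close>.\<close>

lemma eps_exchange:
  assumes "finite Q" "x \<notin> Q" "y \<notin> Q" "x \<noteq> y"
  shows "eps y (insert x Q) * eps x (insert y Q) = - (eps x Q * eps y Q :: 'k::field)"
  using assms by (auto simp: eps_insert)

type_synonym cell = "nat set \<times> nat set"

text \<open>Exterior multiplication by e_t on chains, given by their coefficient functions.\<close>

definition cone :: "nat \<Rightarrow> (cell \<Rightarrow> 'k::field) \<Rightarrow> cell \<Rightarrow> 'k" where
  "cone t z = (\<lambda>(A, Q). if t \<in> Q then eps t (Q - {t}) * z (A, Q - {t}) else 0)"

locale star =
  fixes n s :: nat
begin

text \<open>The contribution of removing \<open>x\<close>, read at the target: from a cell with the
  same \<open>A\<close>, or, for a vertex \<open>x\<close>, from one whose first component loses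
  \<open>x\<close> as well.\<close>

definition face_diff :: "nat \<Rightarrow> (cell \<Rightarrow> 'k::field) \<Rightarrow> nat set \<Rightarrow> nat set \<Rightarrow> 'k" where
  "face_diff x z A R = z (A, R) - (if x \<le> n \<and> x \<notin> A then z (insert x A, R) else 0)"

text \<open>The value of the differential at \<open>(A, Q)\<close> collects the pairs of which it is
  a face, hence the sum over indices outside \<open>Q\<close>. It is defined on all pairs, cells or
  not.\<close>

definition koszul :: "(cell \<Rightarrow> 'k::field) \<Rightarrow> cell \<Rightarrow> 'k" where
  "koszul z = (\<lambda>(A, Q). \<Sum>x\<in>{1..n+s} - Q. eps x Q * face_diff x z A (insert x Q))"

lemma face_diff_sum: "face_diff x (\<lambda>b. \<Sum>i\<in>I. k i * f i b) A R = (\<Sum>i\<in>I. k i * face_diff x (f i) A R)"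
  by (cases "x \<le> n \<and> x \<notin> A") (auto simp: face_diff_def right_diff_distrib sum_subtractf)

lemma koszul_sum: "koszul (\<lambda>b. \<Sum>i\<in>I. k i * f i b) a = (\<Sum>i\<in>I. k i * koszul (f i) a)"
proof (cases a)
  case (Pair A Q)
  show ?thesis
    unfolding Pair koszul_def prod.case face_diff_sum sum_distrib_left
    by (subst sum.swap) (simp add: mult.left_commute)
qed

text \<open>Up to sign, removing \<open>x\<close> and \<open>y\<close> has the same effect in both
  orders: \<open>W\<close> is symmetric while the signs are antisymmetric.\<close>

lemma koszul_koszul:
  assumes "finite Q"
  shows "koszul (koszul z) (A, Q) = 0"
proof -
  let ?X = "{1..n+s} - Q"
  define W where "W x y = face_diff y z A (insert y (insert x Q)) -
    (if x \<le> n \<and> x \<notin> A then face_diff y z (insert x A) (insert y (insert x Q)) else 0)" for x y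
  have "face_diff x (koszul z) A (insert x Q) = (\<Sum>y\<in>?X - {x}. eps y (insert x Q) * W x y)" for x
  proof -
    have X: "?X - {x} = {1..n+s} - insert x Q" by auto
    show ?thesis
      unfolding X W_def face_diff_def[of x "koszul z"] unfolding koszul_def prod.case
      by (cases "x \<le> n \<and> x \<notin> A")
        (simp_all only: if_True if_False simp_thms right_diff_distrib sum_subtractf diff_zero)
  qed
  then have "koszul (koszul z) (A, Q) = (\<Sum>x\<in>?X. \<Sum>y\<in>?X - {x}. eps x Q * eps y (insert x Q) * W x y)"
    unfolding koszul_def[of "koszul z"] prod.case by (simp only: sum_distrib_left mult.assoc)
  also have "\<dots> = 0"
  proof (rule sum_antisym_0)
    fix x y assume *: "x \<in> ?X" "y \<in> ?X" "x \<noteq> y"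
    define N where "N u \<longleftrightarrow> u \<le> n \<and> u \<notin> A" for u
    have N: "x \<le> n \<and> x \<notin> insert y A \<longleftrightarrow> N x" "y \<le> n \<and> y \<notin> insert x A \<longleftrightarrow> N y"
      using *(3) by (auto simp: N_def)
    have "W x y = W y x"
      unfolding W_def face_diff_def insert_commute[of y x] N N_def[symmetric]
      by (cases "N x"; cases "N y") simp_all
    then show "eps x Q * eps y (insert x Q) * W x y = - (eps y Q * eps x (insert y Q) * W y x)"
      using * by (simp only: eps_swap[OF assms, of x y] mult_minus_left Diff_iff simp_thms)
  qed simp
  finally show ?thesis .
qed

text \<open>If \<open>t\<close> is a leaf or lies in \<open>A\<close>, the right-hand side is just
  \<open>z (A, Q)\<close>, and the cone is a contracting homotopy.\<close>

lemma koszul_cone: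
  assumes "finite Q" "t \<in> {1..n+s}"
  shows "koszul (cone t z) (A, Q) + cone t (koszul z) (A, Q) = face_diff t z A Q"
proof (cases "t \<in> Q")
  case False
  have "koszul (cone t z) (A, Q) = (\<Sum>x\<in>{1..n+s} - Q. if x = t then face_diff t z A Q else 0)"
    unfolding koszul_def prod.case
  proof (intro sum.cong refl)
    fix x assume x: "x \<in> {1..n+s} - Q"
    show "eps x Q * face_diff x (cone t z) A (insert x Q) = (if x = t then face_diff t z A Q else 0)"
    proof (cases "x = t")
      case True
      have "eps t Q * face_diff t (cone t z) A (insert t Q) = (eps t Q * eps t Q) * face_diff t z A Q"
        using False by (simp add: face_diff_def cone_def algebra_simps)
      then show ?thesis using True by (simp add: eps_square)
    qed (use False in \<open>simp add: face_diff_def cone_def\<close>)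
  qed
  also have "\<dots> = face_diff t z A Q"
    using False assms(2) by simp
  finally show ?thesis using False by (simp add: cone_def)
next
  case True
  define Q' where "Q' = Q - {t}"
  have Q': "Q = insert t Q'" "t \<notin> Q'" "finite Q'"
    using True assms(1) by (auto simp: Q'_def)
  let ?X = "{1..n+s} - Q"
  have X: "{1..n+s} - Q' = insert t ?X" "t \<notin> ?X"
    using assms(2) Q' by auto
  have "cone t (koszul z) (A, Q) = eps t Q' * koszul z (A, Q')"
    using Q' by (simp add: cone_def)
  also have "\<dots> = eps t Q' * eps t Q' * face_diff t z A Q
      + (\<Sum>x\<in>?X. eps t Q' * eps x Q' * face_diff x z A (insert x Q'))"
    unfolding koszul_def prod.case X(1) using X(2) Q'(1) by (simp add: distrib_left sum_distrib_left mult.assoc)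
  finally have 1: "cone t (koszul z) (A, Q) = face_diff t z A Q
      + (\<Sum>x\<in>?X. eps t Q' * eps x Q' * face_diff x z A (insert x Q'))"
    by (simp add: eps_square)
  have "koszul (cone t z) (A, Q) = (\<Sum>x\<in>?X. - (eps t Q' * eps x Q' * face_diff x z A (insert x Q')))"
    unfolding koszul_def prod.case
  proof (intro sum.cong refl)
    fix x assume x: "x \<in> ?X"
    then have x': "x \<noteq> t" "x \<notin> Q'" using Q' by auto
    have "insert x Q - {t} = insert x Q'" using Q' x' by auto
    then have "face_diff x (cone t z) A (insert x Q) = eps t (insert x Q') * face_diff x z A (insert x Q')"
      using Q'(1) by (simp add: face_diff_def cone_def right_diff_distrib)
    then have "eps x Q * face_diff x (cone t z) A (insert x Q) =
        (eps x (insert t Q') * eps t (insert x Q')) * face_diff x z A (insert x Q')"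
      using Q'(1) by simp
    then show "eps x Q * face_diff x (cone t z) A (insert x Q) = - (eps t Q' * eps x Q' * face_diff x z A (insert x Q'))"
      by (simp only: eps_exchange[OF Q'(3,2) x'(2) x'(1)[symmetric]] mult_minus_left)
  qed
  then show ?thesis using 1 by (simp add: sum_negf)
qed

abbreviation leaves :: "nat set" where "leaves \<equiv> {n+1..n+s}"

text \<open>The basis element \<open>(A, P, T)\<close> is coded by the pair \<open>(A, Q)\<close> with \<open>Q = T \<union> {n + p | p \<in> P}\<close>, so that
  one sign rule serves both directions; \<open>({}, {})\<close> is the generator for \<open>A = {}\<close>. The pair \<open>root\<close> stands for the
  basis element of the ring that is resolved.\<close>

definition cells :: "nat \<Rightarrow> cell set" where
  "cells i = {(A, Q). A \<subseteq> {1..n} \<and> A \<noteq> {} \<and> Q \<subseteq> A \<union> leaves \<and> Q \<inter> leaves \<noteq> {} \<and> card Q = Suc i}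
    \<union> (if i = 0 then {({}, {})} else {})"

text \<open>The index 0 lies outside \<open>{1..n+s}\<close>, so \<open>root\<close> is not a
  cell.\<close>

abbreviation root :: cell where "root \<equiv> ({}, {0})"

text \<open>The row of \<open>({}, {})\<close> is the sum over \<open>q\<close> of the
  \<open>koszul\<close> rows at the merged pairs \<open>({}, {q})\<close>, evaluated on chains of
  cells; the minus sign is that of \<open>face_diff\<close>. The row of \<open>root\<close> is the
  augmentation.\<close>

definition boundary :: "(cell \<Rightarrow> 'k::field) \<Rightarrow> cell \<Rightarrow> 'k" where
  "boundary z a = (if a = root then \<Sum>b\<in>cells 0. z b
     else if a = ({}, {}) then - (\<Sum>q\<in>leaves. \<Sum>t\<in>{1..n}. z ({t}, {t, q}))
     else koszul z a)"

lemma boundary_koszul: "A \<noteq> {} \<Longrightarrow> boundary z (A, Q) = koszul z (A, Q)"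
  by (simp add: boundary_def)

lemma boundary_sum: "boundary (\<lambda>b. \<Sum>i\<in>I. k i * f i b) a = (\<Sum>i\<in>I. k i * boundary (f i) a)"
proof -
  have aug: "(\<Sum>b\<in>cells 0. \<Sum>i\<in>I. k i * f i b) = (\<Sum>i\<in>I. k i * (\<Sum>b\<in>cells 0. f i b))"
    unfolding sum_distrib_left by (rule sum.swap)
  have "(\<Sum>q\<in>leaves. \<Sum>t\<in>{1..n}. \<Sum>i\<in>I. k i * f i ({t}, {t, q})) =
      (\<Sum>q\<in>leaves. \<Sum>i\<in>I. \<Sum>t\<in>{1..n}. k i * f i ({t}, {t, q}))"
    by (intro sum.cong refl sum.swap)
  also have "\<dots> = (\<Sum>i\<in>I. \<Sum>q\<in>leaves. \<Sum>t\<in>{1..n}. k i * f i ({t}, {t, q}))"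
    by (rule sum.swap)
  finally have e: "(\<Sum>q\<in>leaves. \<Sum>t\<in>{1..n}. \<Sum>i\<in>I. k i * f i ({t}, {t, q})) =
      (\<Sum>i\<in>I. k i * (\<Sum>q\<in>leaves. \<Sum>t\<in>{1..n}. f i ({t}, {t, q})))"
    by (simp add: sum_distrib_left)
  consider "a = root" | "a = ({}, {})" | "a \<noteq> root" "a \<noteq> ({}, {})" by fast
  then show ?thesis
  proof cases
    case 1
    then show ?thesis by (simp only: boundary_def simp_thms if_True aug)
  next
    case 2
    then have "a \<noteq> root" by simp
    with 2 show ?thesis by (simp only: boundary_def simp_thms if_True if_False e mult_minus_right sum_negf)
  next
    case 3
    then show ?thesis by (simp only: boundary_def if_False koszul_sum)
  qed
qed

text \<open>The matrix of the operator \<open>boundary\<close>, which \<open>labelled_cplx\<close>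
  expects; the arguments below use the operator.\<close>

definition coef :: "cell \<Rightarrow> cell \<Rightarrow> 'k::field" where
  "coef a b = boundary (\<lambda>b'. if b' = b then 1 else 0) a"

lemma boundary_coef:
  assumes "finite X" "\<And>b. z b \<noteq> 0 \<Longrightarrow> b \<in> X"
  shows "(\<Sum>b\<in>X. coef a b * z b) = boundary z a"
proof -
  have "z = (\<lambda>b'. \<Sum>b\<in>X. z b * (if b' = b then 1 else 0))"
  proof (rule ext)
    fix b'
    have "z b' = 0" if "b' \<notin> X"
      using that assms(2) by (rule contrapos_np)
    then show "z b' = (\<Sum>b\<in>X. z b * (if b' = b then 1 else 0))"
      using assms(1) by (cases "b' \<in> X") (simp_all add: if_distrib[of "\<lambda>c. _ * c"] cong: if_cong)
  qed
  then have "boundary z a = boundary (\<lambda>b'. \<Sum>b\<in>X. z b * (if b' = b then 1 else 0)) a"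
    by simp
  also have "\<dots> = (\<Sum>b\<in>X. coef a b * z b)"
    unfolding boundary_sum coef_def by (simp add: mult.commute)
  finally show ?thesis by simp
qed

lemma boundary_add: "boundary (\<lambda>b. y b + z b) a = boundary y a + boundary z a"
  using boundary_sum[of "\<lambda>_. 1" "\<lambda>i. if i then y else z" UNIV a] by (simp add: UNIV_bool add.commute)

lemma boundary_diff: "boundary (\<lambda>b. y b - z b) a = boundary y a - boundary z a"
  using boundary_sum[of "\<lambda>i. if i then 1 else - 1" "\<lambda>i. if i then y else z" UNIV a]
  by (simp add: UNIV_bool)

lemma finite_cells: "finite (cells i)"
proof (rule finite_subset)
  show "cells i \<subseteq> Pow {1..n} \<times> Pow {0..n+s}"
  proof
    fix a assume "a \<in> cells i"
    then obtain A Q where "a = (A, Q)" "A \<subseteq> {1..n}" "Q \<subseteq> A \<union> leaves"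
      by (auto simp: cells_def split: if_splits)
    then show "a \<in> Pow {1..n} \<times> Pow {0..n+s}"
      by (auto dest!: subsetD)
  qed
qed simp

lemma cells_finite: "(A, Q) \<in> cells i \<Longrightarrow> finite Q"
proof -
  assume "(A, Q) \<in> cells i"
  then have "card Q > 0 \<or> Q = {}"
    by (auto simp: cells_def split: if_splits)
  then show "finite Q"
    using card_ge_0_finite by auto
qed

lemma cells_iff: "(A, Q) \<in> cells i \<longleftrightarrow> A = {} \<and> Q = {} \<and> i = 0 \<or>
    A \<subseteq> {1..n} \<and> A \<noteq> {} \<and> Q \<subseteq> A \<union> leaves \<and> Q \<inter> leaves \<noteq> {} \<and> card Q = Suc i"
  by (auto simp: cells_def)

lemma koszul_neq_0:
  assumes "koszul z (A, Q) \<noteq> 0"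
  obtains x where "x \<in> {1..n+s} - Q" "z (A, insert x Q) \<noteq> 0"
  | x where "x \<in> {1..n} - Q" "x \<notin> A" "z (insert x A, insert x Q) \<noteq> 0"
proof -
  obtain x where x: "x \<in> {1..n+s} - Q" "eps x Q * face_diff x z A (insert x Q) \<noteq> 0"
    using sum.not_neutral_contains_not_neutral[OF assms[unfolded koszul_def prod.case]] .
  show thesis
  proof (cases "z (A, insert x Q) = 0")
    case True
    then have "x \<le> n \<and> x \<notin> A" "z (insert x A, insert x Q) \<noteq> 0"
      using x(2) by (auto simp: face_diff_def split: if_splits)
    then show thesis using x(1) by (intro that(2)[of x]) auto
  next
    case False
    then show thesis using that(1) x(1) by blast
  qed
qed

lemma koszul_cong:
  assumes "\<And>x. x \<in> {1..n+s} - Q \<Longrightarrow> y (A, insert x Q) = z (A, insert x Q)"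
    "\<And>x. x \<in> {1..n} - Q \<Longrightarrow> x \<notin> A \<Longrightarrow> y (insert x A, insert x Q) = z (insert x A, insert x Q)"
  shows "koszul y (A, Q) = koszul z (A, Q)"
  unfolding koszul_def prod.case face_diff_def
  by (intro sum.cong refl) (use assms in \<open>auto simp del: insert_iff\<close>)

text \<open>A face of a cell fails to be a cell only if \<open>A\<close> becomes empty or the last
  leaf disappears, which the hypotheses exclude.\<close>

lemma koszul_support:
  assumes z: "\<And>b. z b \<noteq> 0 \<Longrightarrow> b \<in> cells (Suc i)"
    and A: "A \<noteq> {}" and Q: "Q \<inter> leaves \<noteq> {}" "finite Q" and nz: "koszul z (A, Q) \<noteq> 0"
  shows "(A, Q) \<in> cells i"
  using nz
proof (cases rule: koszul_neq_0)
  case (1 x)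
  then show ?thesis using z[OF 1(2)] A Q by (auto simp: cells_iff)
next
  case (2 x)
  then have "(insert x A, insert x Q) \<in> cells (Suc i)" by (intro z)
  then have "A \<subseteq> {1..n}" "insert x Q \<subseteq> insert x A \<union> leaves" "card (insert x Q) = Suc (Suc i)"
    unfolding cells_iff by auto
  then show ?thesis using 2(1,2) A Q unfolding cells_iff by auto
qed

lemma eps_empty: "eps x {} = 1"
  by (simp add: eps_def)

lemma eps_singleton: "q \<noteq> x \<Longrightarrow> eps x {q} = (if q < x then - 1 else 1 :: 'k::field)"
  by (simp add: eps_insert eps_empty)

text \<open>Vertices precede leaves in the order, so the vertex terms carry the sign +1.\<close>

lemma koszul_leaf:
  assumes q: "q \<in> leaves"
  shows "koszul z (A, {q}) = (\<Sum>t\<in>{1..n}. z (A, {t, q}) - (if t \<notin> A then z (insert t A, {t, q}) else 0))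
    + (\<Sum>x\<in>leaves - {q}. eps x {q} * z (A, {x, q}))"
proof -
  have X: "{1..n+s} - {q} = {1..n} \<union> (leaves - {q})"
    using q by auto
  have 1: "koszul z (A, {q}) = (\<Sum>t\<in>{1..n}. eps t {q} * face_diff t z A {t, q}) +
      (\<Sum>x\<in>leaves - {q}. eps x {q} * face_diff x z A {x, q})"
    unfolding koszul_def prod.case X by (intro sum.union_disjoint) auto
  have 2: "eps t {q} * face_diff t z A {t, q} = z (A, {t, q}) - (if t \<notin> A then z (insert t A, {t, q}) else 0)"
    if "t \<in> {1..n}" for t
  proof -
    have "t \<le> n" "q \<noteq> t" "\<not> q < t" using that q by auto
    then show ?thesis by (simp add: face_diff_def eps_singleton)
  qed
  have 3: "eps x {q} * face_diff x z A {x, q} = eps x {q} * z (A, {x, q})" if "x \<in> leaves - {q}" for x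
    using that by (auto simp: face_diff_def)
  show ?thesis
    unfolding 1 by (intro arg_cong2[of _ _ _ _ "(+)"] sum.cong refl 2 3)
qed

section \<open>The boundary of a boundary vanishes\<close>

lemma leaf_sum_0:
  "(\<Sum>q\<in>leaves. \<Sum>x\<in>leaves - {q}. eps x {q} * f {x, q}) = (0 :: 'k::field)"
proof (rule sum_antisym_0)
  fix q x assume "q \<in> leaves" "x \<in> leaves" "q \<noteq> x"
  have "eps x {q} = - (eps q {x} :: 'k)"
    using \<open>q \<noteq> x\<close> by (auto simp: eps_singleton)
  then show "eps x {q} * f {x, q} = - (eps q {x} * f {q, x})"
    by (simp add: insert_commute)
qed simp

lemma sum_cells_0:
  "(\<Sum>b\<in>cells 0. w b) = w ({}, {}) + (\<Sum>q\<in>leaves. \<Sum>A\<in>Pow {1..n} - {{}}. w (A, {q}))"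
proof -
  let ?P = "Pow {1..n} - {{}}" and ?g = "\<lambda>(q, A). (A, {q})"
  have "cells 0 = insert ({}, {}) (?g ` (leaves \<times> ?P))"
  proof (intro subset_antisym subsetI)
    fix b assume b: "b \<in> cells 0"
    obtain A Q where AQ: "b = (A, Q)" by (cases b)
    show "b \<in> insert ({}, {}) (?g ` (leaves \<times> ?P))"
    proof (cases "A = {}")
      case True
      then show ?thesis using b AQ by (auto simp: cells_iff)
    next
      case False
      then have A: "A \<in> ?P" "Q \<inter> leaves \<noteq> {}" "card Q = Suc 0"
        using b AQ by (auto simp: cells_iff)
      then obtain q where "Q = {q}" by (auto simp: card_Suc_eq)
      then show ?thesis using A AQ by (auto intro!: image_eqI[of _ _ "(q, A)"])
    qed
  next
    fix b assume "b \<in> insert ({}, {}) (?g ` (leaves \<times> ?P))"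
    then show "b \<in> cells 0" by (auto simp: cells_iff)
  qed
  moreover have "inj_on ?g (leaves \<times> ?P)"
    by (auto simp: inj_on_def)
  moreover have "({}, {}) \<notin> ?g ` (leaves \<times> ?P)" by auto
  ultimately have "(\<Sum>b\<in>cells 0. w b) = w ({}, {}) + (\<Sum>p\<in>leaves \<times> ?P. w (?g p))"
    by (simp add: sum.reindex)
  also have "(\<Sum>p\<in>leaves \<times> ?P. w (?g p)) = (\<Sum>q\<in>leaves. \<Sum>A\<in>?P. w (A, {q}))"
    by (simp add: sum.cartesian_product case_prod_unfold)
  finally show ?thesis .
qed

definition base :: "nat \<Rightarrow> cell set" where
  "base i = (case i of 0 \<Rightarrow> {root} | Suc j \<Rightarrow> cells j)"

lemma base_simps [simp]: "base 0 = {root}" "base (Suc i) = cells i"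
  by (simp_all add: base_def)

text \<open>\<open>boundary\<close> can be nonzero outside the cells of degree \<open>i\<close>, for
  instance at \<open>root\<close>; truncation gives a chain to which it can be applied
  again.\<close>

definition cell_boundary :: "nat \<Rightarrow> (cell \<Rightarrow> 'k::field) \<Rightarrow> cell \<Rightarrow> 'k" where
  "cell_boundary i z a = (if a \<in> cells i then boundary z a else 0)"

lemma cell_boundary_koszul:
  assumes z: "\<And>b. z b \<noteq> 0 \<Longrightarrow> b \<in> cells (Suc i)"
    and "A \<noteq> {}" "Q \<inter> leaves \<noteq> {}" "finite Q"
  shows "cell_boundary i z (A, Q) = koszul z (A, Q)"
  using koszul_support[OF assms] boundary_koszul[OF assms(2)] unfolding cell_boundary_def by auto

lemma boundary_cell_boundary:
  fixes z :: "cell \<Rightarrow> 'k::field"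
  assumes z: "\<And>b. z b \<noteq> 0 \<Longrightarrow> b \<in> cells (Suc i)" and a: "a \<in> base i"
  shows "boundary (cell_boundary i z) a = 0"
proof (cases i)
  case 0
  let ?P = "Pow {1..n} - {{}}"
  have i: "i = 0" by fact
  have z': "z (A, Q) = 0" if "A = {} \<or> \<not> Q \<subseteq> A \<union> leaves" for A Q
    using z[of "(A, Q)"] that by (auto simp: cells_iff)
  have "koszul z ({}, {q}) = - (\<Sum>t\<in>{1..n}. z ({t}, {t, q}))" if "q \<in> leaves" for q
    using that by (simp add: koszul_leaf z' sum_negf)
  then have e: "cell_boundary i z ({}, {}) = (\<Sum>q\<in>leaves. koszul z ({}, {q}))"
    by (simp add: cell_boundary_def i cells_iff boundary_def sum_negf)
  have rest: "(\<Sum>q\<in>leaves. \<Sum>A\<in>?P. cell_boundary i z (A, {q})) = (\<Sum>q\<in>leaves. \<Sum>A\<in>?P. koszul z (A, {q}))"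
    by (intro sum.cong refl cell_boundary_koszul z) auto
  have "boundary (cell_boundary i z) a = (\<Sum>q\<in>leaves. koszul z ({}, {q}) + (\<Sum>A\<in>?P. koszul z (A, {q})))"
  proof -
    have "boundary (cell_boundary i z) a = (\<Sum>b\<in>cells 0. cell_boundary i z b)"
      using a by (simp add: i boundary_def)
    then show ?thesis
      unfolding sum_cells_0 e rest by (simp only: sum.distrib)
  qed
  \<comment> \<open>The row of \<open>({}, {})\<close> supplies the missing summand
    \<open>A = {}\<close>.\<close>
  also have "\<dots> = (\<Sum>q\<in>leaves. \<Sum>A\<in>Pow {1..n}. koszul z (A, {q}))"
    by (intro sum.cong refl sum.remove[symmetric]) auto
  also have "\<dots> = (\<Sum>q\<in>leaves. \<Sum>x\<in>leaves - {q}. eps x {q} * (\<Sum>A\<in>Pow {1..n}. z (A, {x, q})))"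
  proof (intro sum.cong refl)
    fix q assume q: "q \<in> leaves"
    have "(\<Sum>A\<in>Pow {1..n}. z (A, {t, q}) - (if t \<notin> A then z (insert t A, {t, q}) else 0)) = 0"
      if t: "t \<in> {1..n}" for t
    proof -
      let ?T = "{A \<in> Pow {1..n}. t \<notin> A}"
      \<comment> \<open>The second face term at \<open>A\<close> is the first one at
        \<open>insert t A\<close>, and the first one vanishes when \<open>t\<close> is not in
        \<open>A\<close>; so the two sums over \<open>A\<close> agree.\<close>
      have bij: "bij_betw (insert t) ?T {A \<in> Pow {1..n}. t \<in> A}"
        using t by (intro bij_betw_byWitness[of _ "\<lambda>A. A - {t}"]) auto
      have "(\<Sum>A\<in>Pow {1..n}. if t \<notin> A then z (insert t A, {t, q}) else 0) =
          (\<Sum>A\<in>?T. z (insert t A, {t, q}))"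
        by (rule sum.inter_filter[symmetric]) simp
      also have "(\<Sum>A\<in>?T. z (insert t A, {t, q})) = (\<Sum>A\<in>{A \<in> Pow {1..n}. t \<in> A}. z (A, {t, q}))"
        by (rule sum.reindex_bij_betw[OF bij])
      also have "\<dots> = (\<Sum>A\<in>Pow {1..n}. z (A, {t, q}))"
        using t q z' by (intro sum.mono_neutral_left) auto
      finally show ?thesis
        by (simp only: sum_subtractf diff_self)
    qed
    then have "(\<Sum>A\<in>Pow {1..n}. \<Sum>t\<in>{1..n}. z (A, {t, q}) -
        (if t \<notin> A then z (insert t A, {t, q}) else 0)) = 0"
      by (subst sum.swap) simp
    then show "(\<Sum>A\<in>Pow {1..n}. koszul z (A, {q})) =
        (\<Sum>x\<in>leaves - {q}. eps x {q} * (\<Sum>A\<in>Pow {1..n}. z (A, {x, q})))"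
      unfolding koszul_leaf[OF q] sum.distrib sum_distrib_left
      by (subst (2) sum.swap) simp
  qed
  also have "\<dots> = 0"
    by (rule leaf_sum_0)
  finally show ?thesis .
next
  case (Suc j)
  obtain A Q where AQ: "a = (A, Q)" by (cases a)
  show ?thesis
  proof (cases "A = {}")
    case False
    then have Q: "Q \<inter> leaves \<noteq> {}" "finite Q"
      using a cells_finite[of A Q j] unfolding AQ Suc by (auto simp: cells_iff)
    have "koszul (cell_boundary i z) (A, Q) = koszul (koszul z) (A, Q)"
      using False Q by (intro koszul_cong cell_boundary_koszul z) auto
    then show ?thesis using False by (simp add: AQ boundary_koszul koszul_koszul[OF Q(2)])
  next
    case True
    then have Q: "Q = {}" using a unfolding AQ Suc by (simp add: cells_iff)
    have z': "z (A, Q) = 0" if "A = {} \<or> \<not> Q \<subseteq> A \<union> leaves" for A Q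
      using z[of "(A, Q)"] that by (auto simp: cells_iff)
    have K0: "koszul z ({}, {t, q}) = 0" if "t \<in> {1..n}" for t q
    proof (rule ccontr)
      assume "koszul z ({}, {t, q}) \<noteq> 0"
      then show False
        by (cases rule: koszul_neq_0) (use that in \<open>auto simp: z'\<close>)
    qed
    \<comment> \<open>At the merged cell the identity is the sum of those at the pairs
      \<open>({}, {q})\<close>; the surplus terms are antisymmetric in two leaves.\<close>
    have "0 = (\<Sum>q\<in>leaves. koszul (koszul z) ({}, {q}))"
      by (simp add: koszul_koszul)
    also have "\<dots> = - (\<Sum>q\<in>leaves. \<Sum>t\<in>{1..n}. koszul z ({t}, {t, q})) +
       (\<Sum>q\<in>leaves. \<Sum>x\<in>leaves - {q}. eps x {q} * koszul z ({}, {x, q}))"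
      by (simp add: koszul_leaf K0 sum.distrib sum_negf sum_subtractf)
    also have "\<dots> = - (\<Sum>q\<in>leaves. \<Sum>t\<in>{1..n}. koszul z ({t}, {t, q}))"
      unfolding leaf_sum_0[of "\<lambda>R. koszul z ({}, R)"] by simp
    also have "\<dots> = - (\<Sum>q\<in>leaves. \<Sum>t\<in>{1..n}. cell_boundary i z ({t}, {t, q}))"
      by (intro arg_cong[of _ _ uminus] sum.cong refl cell_boundary_koszul[symmetric] z) auto
    also have "\<dots> = boundary (cell_boundary i z) a"
      by (simp add: AQ True Q boundary_def)
    finally show ?thesis by simp
  qed
qed

section \<open>Multidegrees of cells\<close>

definition label_vars :: "cell \<Rightarrow> (nat \<times> nat) set" where
  "label_vars = (\<lambda>(A, Q). A \<times> {j \<in> {1..s}. n + j \<in> Q} \<union> ({1..n} - (A - Q)) \<times> {s + 1})"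

lemma mem_label_vars: "(i, j) \<in> label_vars (A, Q) \<longleftrightarrow>
    i \<in> A \<and> 1 \<le> j \<and> j \<le> s \<and> n + j \<in> Q \<or> j = s + 1 \<and> 1 \<le> i \<and> i \<le> n \<and> (i \<notin> A \<or> i \<in> Q)"
  by (auto simp: label_vars_def)

text \<open>Every face loses a variable: y_x if \<open>x\<close> leaves T only, x_{ip} with i in A
  if the leaf p is removed, and x_{xq} for a leaf q of \<open>Q\<close> if \<open>x\<close> leaves A
  and T. Inclusion yields homogeneity, strictness yields minimality.\<close>

lemma boundary_label:
  assumes z: "\<And>b. z b \<noteq> 0 \<Longrightarrow> b \<in> cells (Suc i)" and a: "a \<in> cells i" and nz: "boundary z a \<noteq> 0"
  shows "\<exists>b. z b \<noteq> 0 \<and> label_vars a \<subset> label_vars b"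
proof -
  obtain A Q where AQ: "a = (A, Q)" by (cases a)
  show ?thesis
  proof (cases "A = {}")
    case True
    then have a: "a = ({}, {})" using a AQ by (simp add: cells_iff)
    then have "\<exists>q\<in>leaves. \<exists>t\<in>{1..n}. z ({t}, {t, q}) \<noteq> 0"
      using nz by (intro ccontr[of "Bex _ _"]) (simp add: boundary_def)
    then obtain q t where qt: "q \<in> leaves" "t \<in> {1..n}" "z ({t}, {t, q}) \<noteq> 0" by blast
    have "label_vars a \<subseteq> label_vars ({t}, {t, q})"
      by (auto simp: a mem_label_vars)
    moreover have "(t, q - n) \<in> label_vars ({t}, {t, q}) - label_vars a"
      using qt(1,2) by (auto simp: a mem_label_vars)
    ultimately show ?thesis using qt(3) by blast
  next
    case False
    then have Q: "Q \<subseteq> A \<union> leaves" "Q \<inter> leaves \<noteq> {}" using a AQ by (auto simp: cells_iff)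
    have "koszul z (A, Q) \<noteq> 0" using nz False by (simp add: AQ boundary_koszul)
    then show ?thesis
    proof (cases rule: koszul_neq_0)
      case (1 x)
      then have x: "x \<notin> Q" "x \<in> A \<union> leaves" "A \<subseteq> {1..n}"
        using z[OF 1(2)] False by (auto simp: cells_iff)
      have "label_vars a \<subseteq> label_vars (A, insert x Q)"
        by (auto simp: AQ mem_label_vars)
      moreover have "\<exists>v. v \<in> label_vars (A, insert x Q) - label_vars a"
      proof (cases "x \<in> A")
        case True
        then have "(x, s + 1) \<in> label_vars (A, insert x Q) - label_vars a"
          using x by (auto simp: AQ mem_label_vars)
        then show ?thesis ..
      next
        case False
        obtain i where "i \<in> A" using \<open>A \<noteq> {}\<close> by blast
        then have "(i, x - n) \<in> label_vars (A, insert x Q) - label_vars a"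
          using x False by (auto simp: AQ mem_label_vars)
        then show ?thesis ..
      qed
      ultimately show ?thesis using 1(2) by blast
    next
      case (2 x)
      obtain q where q: "q \<in> Q" "q \<in> leaves" using Q by blast
      have "label_vars a \<subseteq> label_vars (insert x A, insert x Q)"
        by (auto simp: AQ mem_label_vars)
      moreover have "(x, q - n) \<in> label_vars (insert x A, insert x Q) - label_vars a"
        using q 2(1,2) by (auto simp: AQ mem_label_vars)
      ultimately show ?thesis using 2(3) by blast
    qed
  qed
qed

section \<open>Acyclicity of the subcomplex of cells with variables in a given set\<close>

definition supp_on :: "nat \<Rightarrow> (nat \<times> nat) set \<Rightarrow> (cell \<Rightarrow> 'k::field) \<Rightarrow> bool" where
  "supp_on i M z \<longleftrightarrow> (\<forall>b. z b \<noteq> 0 \<longrightarrow> b \<in> cells i \<and> label_vars b \<subseteq> M)"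

definition cycle :: "nat \<Rightarrow> (cell \<Rightarrow> 'k::field) \<Rightarrow> bool" where
  "cycle i z \<longleftrightarrow> (\<forall>a\<in>base i. boundary z a = 0)"

lemma supp_onD: "supp_on i M z \<Longrightarrow> z b \<noteq> 0 \<Longrightarrow> b \<in> cells i"
  unfolding supp_on_def by blast

lemma supp_on_add:
  assumes "supp_on i M y" "supp_on i M z"
  shows "supp_on i M (\<lambda>b. y b + z b)"
  unfolding supp_on_def
proof (intro allI impI)
  fix b assume "y b + z b \<noteq> 0"
  then have "y b \<noteq> 0 \<or> z b \<noteq> 0" by auto
  then show "b \<in> cells i \<and> label_vars b \<subseteq> M"
    using assms unfolding supp_on_def by blast
qed

text \<open>Allows a cycle to be improved by boundaries: labels shrink along the differential, so
  the variables stay in \<open>M\<close>.\<close>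

lemma remainder:
  assumes "supp_on i M z" "cycle i z" "supp_on (Suc i) M w"
  shows "supp_on i M (\<lambda>a. z a - cell_boundary i w a)" "cycle i (\<lambda>a. z a - cell_boundary i w a)"
proof -
  have "b \<in> cells i \<and> label_vars b \<subseteq> M" if "z b - cell_boundary i w b \<noteq> 0" for b
  proof (cases "cell_boundary i w b = 0")
    case True
    then have "z b \<noteq> 0" using that by simp
    then show ?thesis using assms(1) unfolding supp_on_def by blast
  next
    case False
    then have b: "b \<in> cells i" "boundary w b \<noteq> 0" by (auto simp: cell_boundary_def split: if_splits)
    then obtain b' where "w b' \<noteq> 0" "label_vars b \<subset> label_vars b'"
      using boundary_label[OF supp_onD[OF assms(3)]] by blast
    then show ?thesis using b assms(3) unfolding supp_on_def by blast
  qed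
  then show "supp_on i M (\<lambda>a. z a - cell_boundary i w a)"
    unfolding supp_on_def by blast
  show "cycle i (\<lambda>a. z a - cell_boundary i w a)"
    unfolding cycle_def
  proof
    fix a assume a: "a \<in> base i"
    have "boundary (cell_boundary i w) a = 0"
      by (rule boundary_cell_boundary[OF _ a]) (rule supp_onD[OF assms(3)])
    then show "boundary (\<lambda>a. z a - cell_boundary i w a) a = 0"
      using assms(2) a by (simp add: cycle_def boundary_diff)
  qed
qed

lemma cycle_koszul:
  assumes "cycle i z" "(A, Q) \<in> cells i" "A \<noteq> {}" "t \<in> Q" "(Q - {t}) \<inter> leaves \<noteq> {}"
  shows "koszul z (A, Q - {t}) = 0"
proof (cases i)
  case 0
  then have "card Q = 1" using assms(2,3) by (simp add: cells_iff)
  then have "Q = {t}" using assms(4) by (auto simp: card_1_singleton_iff)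
  then show ?thesis using assms(5) by simp
next
  case (Suc j)
  have "finite Q" using cells_finite[OF assms(2)] .
  then have "(A, Q - {t}) \<in> cells j"
    using assms by (auto simp: cells_iff Suc)
  then show ?thesis
    using assms(1,3) by (auto simp: cycle_def Suc boundary_koszul[symmetric])
qed

text \<open>On cells with \<open>t \<in> A\<close> the cone with apex \<open>t\<close> is a contraction, so that a cycle can be moved
  away from these cells.\<close>

lemma kill_vertex:
  fixes y :: "cell \<Rightarrow> 'k::field"
  assumes t: "t \<in> {1..n}" "(t, s + 1) \<in> M" and y: "supp_on i M y" "cycle i y"
    and Y: "\<And>A Q. A \<inter> Y \<noteq> {} \<Longrightarrow> y (A, Q) = 0"
  shows "\<exists>w. supp_on (Suc i) M w \<and>
    (\<forall>A Q. (A, Q) \<in> cells i \<longrightarrow> A \<inter> insert t Y \<noteq> {} \<longrightarrow> boundary w (A, Q) = y (A, Q))"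
proof (intro exI conjI allI impI)
  \<comment> \<open>Cells without \<open>t\<close> are dropped because the cone with apex
    \<open>t\<close> contracts only where \<open>t\<close> lies in \<open>A\<close>.\<close>
  define yt where "yt = (\<lambda>(A, Q). if t \<in> A then y (A, Q) else 0)"
  show "supp_on (Suc i) M (cone t yt)"
    unfolding supp_on_def
  proof (intro allI impI)
    fix b assume b: "cone t yt b \<noteq> 0"
    obtain A Q where AQ: "b = (A, Q)" by (cases b)
    have *: "t \<in> Q" "t \<in> A" "y (A, Q - {t}) \<noteq> 0"
      using b by (auto simp: AQ cone_def yt_def split: if_splits)
    then have c: "(A, Q - {t}) \<in> cells i" "label_vars (A, Q - {t}) \<subseteq> M"
      using y(1) unfolding supp_on_def by blast+
    have "finite Q" using cells_finite[OF c(1)] by simp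
    then have "b \<in> cells (Suc i)"
      using * c(1) by (auto simp: AQ cells_iff card_Diff_singleton card_gt_0_iff)
    \<comment> \<open>Adding \<open>t\<close> to \<open>Q\<close> costs at most the variable y_t,
      which lies in \<open>M\<close> by assumption.\<close>
    moreover have "label_vars b \<subseteq> insert (t, s + 1) (label_vars (A, Q - {t}))"
      using t by (auto simp: AQ mem_label_vars)
    ultimately show "b \<in> cells (Suc i) \<and> label_vars b \<subseteq> M"
      using c(2) t(2) by blast
  qed
  fix A Q assume AQ: "(A, Q) \<in> cells i" and A: "A \<inter> insert t Y \<noteq> {}"
  then have ne: "A \<noteq> {}" by blast
  have Q: "Q \<inter> leaves \<noteq> {}" "finite Q"
    using AQ ne cells_finite[OF AQ] by (auto simp: cells_iff)
  show "boundary (cone t yt) (A, Q) = y (A, Q)"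
  proof (cases "t \<in> A")
    case True
    have "koszul yt (A, Q - {t}) = 0" if "t \<in> Q"
    proof -
      have "koszul yt (A, Q - {t}) = koszul y (A, Q - {t})"
        using True by (intro koszul_cong) (auto simp: yt_def)
      also have "(Q - {t}) \<inter> leaves \<noteq> {}"
        using Q(1) t(1) by auto
      then have "koszul y (A, Q - {t}) = 0"
        by (rule cycle_koszul[OF y(2) AQ ne that])
      finally show ?thesis .
    qed
    then have "cone t (koszul yt) (A, Q) = 0"
      by (simp add: cone_def)
    then have "koszul (cone t yt) (A, Q) = face_diff t yt A Q"
      using koszul_cone[OF Q(2), of t yt A] t(1) by simp
    then show ?thesis using True ne by (simp add: boundary_koszul face_diff_def yt_def)
  next
    \<comment> \<open>A cell meeting \<open>Y\<close> is a face only of cells meeting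
      \<open>Y\<close>, where \<open>y\<close> is zero. The correction for \<open>t\<close> leaves
      the earlier vertices undisturbed.\<close>
    case False
    then have AY: "A \<inter> Y \<noteq> {}" using A by blast
    then have "insert x A \<inter> Y \<noteq> {}" for x by blast
    then have "koszul (cone t yt) (A, Q) = koszul (\<lambda>_. 0) (A, Q)"
      using AY by (intro koszul_cong) (simp_all add: cone_def yt_def Y del: insert_iff)
    then show ?thesis using ne Y[OF AY] by (simp add: boundary_koszul koszul_def face_diff_def)
  qed
qed

lemma kill_vertices:
  fixes z :: "cell \<Rightarrow> 'k::field"
  assumes "supp_on i M z" "cycle i z" "finite Y" "Y \<subseteq> {t \<in> {1..n}. (t, s + 1) \<in> M}"
  shows "\<exists>w. supp_on (Suc i) M w \<and>
    (\<forall>A Q. (A, Q) \<in> cells i \<longrightarrow> A \<inter> Y \<noteq> {} \<longrightarrow> boundary w (A, Q) = z (A, Q))"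
  using assms(3,4)
proof (induction Y)
  case empty
  then show ?case by (intro exI[of _ "\<lambda>_. 0"]) (simp add: supp_on_def)
next
  case (insert t Y)
  then obtain w where w: "supp_on (Suc i) M w"
    "\<forall>A Q. (A, Q) \<in> cells i \<longrightarrow> A \<inter> Y \<noteq> {} \<longrightarrow> boundary w (A, Q) = z (A, Q)"
    by auto
  define y where "y = (\<lambda>a. z a - cell_boundary i w a)"
  have y: "supp_on i M y" "cycle i y"
    unfolding y_def by (rule remainder[OF assms(1,2) w(1)])+
  have Y: "y (A, Q) = 0" if "A \<inter> Y \<noteq> {}" for A Q
  proof (cases "(A, Q) \<in> cells i")
    case True
    then show ?thesis using w(2) that by (simp add: y_def cell_boundary_def)
  next
    case False
    then show ?thesis using supp_onD[OF y(1)] by blast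
  qed
  have "t \<in> {1..n}" "(t, s + 1) \<in> M" using insert.prems by auto
  from kill_vertex[OF this y Y] obtain v where v: "supp_on (Suc i) M v"
    "\<forall>A Q. (A, Q) \<in> cells i \<longrightarrow> A \<inter> insert t Y \<noteq> {} \<longrightarrow> boundary v (A, Q) = y (A, Q)"
    by blast
  have "supp_on (Suc i) M (\<lambda>b. w b + v b)"
    using w(1) v(1) by (rule supp_on_add)
  moreover have "boundary (\<lambda>b. w b + v b) (A, Q) = z (A, Q)"
    if "(A, Q) \<in> cells i" "A \<inter> insert t Y \<noteq> {}" for A Q
  proof -
    have "boundary v (A, Q) = y (A, Q)" using v(2) that by blast
    then show ?thesis using that(1) by (simp add: boundary_add y_def cell_boundary_def)
  qed
  ultimately show ?case by blast
qed

text \<open>Once the vertices with centre variable in \<open>M\<close> are cleared, the cycle lives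
  on a simplex whose vertices are leaves, and one more cone contracts it.\<close>

lemma acyclic_cells:
  fixes z :: "cell \<Rightarrow> 'k::field"
  assumes z: "supp_on i M z" "cycle i z"
  shows "\<exists>w. supp_on (Suc i) M w \<and> (\<forall>a\<in>cells i. z a = boundary w a)"
proof -
  define Y where "Y = {t \<in> {1..n}. (t, s + 1) \<in> M}"
  define A0 where "A0 = {1..n} - Y"
  obtain w where w: "supp_on (Suc i) M w"
    "\<forall>A Q. (A, Q) \<in> cells i \<longrightarrow> A \<inter> Y \<noteq> {} \<longrightarrow> boundary w (A, Q) = z (A, Q)"
    using kill_vertices[OF z, of Y] by (auto simp: Y_def)
  define y where "y = (\<lambda>a. z a - cell_boundary i w a)"
  have y: "supp_on i M y" "cycle i y"
    unfolding y_def by (rule remainder[OF z w(1)])+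
  \<comment> \<open>A vertex outside \<open>A\<close>, or in \<open>A\<close> and \<open>Q\<close>,
    has its centre variable in \<open>M\<close> and so lies in \<open>Y\<close>, which
    \<open>A\<close> avoids. Hence \<open>A\<close> is the complement of \<open>Y\<close> and T is
    empty.\<close>
  have supp: "A = A0" "Q \<subseteq> leaves" "(A, Q) \<in> cells i" "label_vars (A, Q) \<subseteq> M" if nz: "y (A, Q) \<noteq> 0" for A Q
  proof -
    show c: "(A, Q) \<in> cells i" and M: "label_vars (A, Q) \<subseteq> M"
      using nz y(1) unfolding supp_on_def by blast+
    have AY: "A \<inter> Y = {}"
    proof (rule ccontr)
      assume "A \<inter> Y \<noteq> {}"
      then have "boundary w (A, Q) = z (A, Q)" using w(2) c by blast
      then show False using nz c by (simp add: y_def cell_boundary_def)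
    qed
    have *: "t \<in> Y" if "t \<in> {1..n}" "t \<notin> A \<or> t \<in> Q" for t
      using that M subsetD[OF M, of "(t, s + 1)"] by (auto simp: Y_def mem_label_vars)
    show "A = A0"
      using AY * c by (auto simp: A0_def cells_iff)
    show "Q \<subseteq> leaves"
    proof
      fix x assume x: "x \<in> Q"
      show "x \<in> leaves"
      proof (rule ccontr)
        assume "x \<notin> leaves"
        moreover have "x \<in> A \<union> leaves" "A \<subseteq> {1..n}"
          using c x by (auto simp only: cells_iff)
        ultimately have "x \<in> A" "x \<in> {1..n}" by auto
        then show False using * x AY by blast
      qed
    qed
  qed
  have "\<exists>v. supp_on (Suc i) M v \<and> (\<forall>a\<in>cells i. y a = boundary v a)"
  proof (cases "\<exists>b. y b \<noteq> 0")
    case False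
    then have "y = (\<lambda>_. 0)" by auto
    then show ?thesis
      by (intro exI[of _ "\<lambda>_. 0"]) (simp add: supp_on_def boundary_def koszul_def face_diff_def split: prod.splits)
  next
    case True
    then obtain Q0 where Q0: "y (A0, Q0) \<noteq> 0" using supp(1) by (metis surj_pair)
    \<comment> \<open>Otherwise \<open>y\<close> would live on \<open>({}, {})\<close> alone, and
      the augmentation would return its nonzero coefficient.\<close>
    have "A0 \<noteq> {}"
    proof
      assume A0: "A0 = {}"
      then have i: "i = 0" and Q0e: "Q0 = {}" using supp(3)[OF Q0] by (auto simp: cells_iff)
      have "y (A, {q}) = 0" if "A \<in> Pow {1..n} - {{}}" for A q
        using supp(1)[of A "{q}"] A0 that by blast
      then have "(\<Sum>b\<in>cells 0. y b) = y ({}, {})"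
        by (simp add: sum_cells_0)
      moreover have "(\<Sum>b\<in>cells 0. y b) = 0"
        using y(2) by (simp add: cycle_def i boundary_def)
      ultimately show False using Q0 by (simp add: A0 Q0e)
    qed
    then have "Q0 \<inter> leaves \<noteq> {}" using supp(3)[OF Q0] by (simp add: cells_iff)
    \<comment> \<open>The apex comes from a cell in the support of \<open>y\<close>, so the
      variables it adds to a label, those of (i, p - n) with i in \<open>A0\<close>, already lie in
      \<open>M\<close>.\<close>
    then obtain p where p: "p \<in> Q0" "p \<in> leaves" by blast
    have p_notin: "p \<notin> {1..n}" "p \<in> {1..n+s}" using p(2) by auto
    have "supp_on (Suc i) M (cone p y)"
      unfolding supp_on_def
    proof (intro allI impI)
      fix b assume b: "cone p y b \<noteq> 0"
      obtain A Q where AQ: "b = (A, Q)" by (cases b)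
      have pQ: "p \<in> Q" and nz: "y (A, Q - {p}) \<noteq> 0"
        using b by (auto simp: AQ cone_def split: if_splits)
      note c = supp[OF nz]
      have "finite Q" using cells_finite[OF c(3)] by simp
      then have "b \<in> cells (Suc i)"
        using pQ p(2) c \<open>A0 \<noteq> {}\<close> by (auto simp: AQ cells_iff card_Diff_singleton card_gt_0_iff)
      moreover have "label_vars b \<subseteq> label_vars (A, Q - {p}) \<union> label_vars (A0, Q0)"
        using p p_notin c(1) by (auto simp: AQ mem_label_vars)
      ultimately show "b \<in> cells (Suc i) \<and> label_vars b \<subseteq> M"
        using c(4) supp(4)[OF Q0] by blast
    qed
    moreover have "boundary (cone p y) (A, Q) = y (A, Q)" if AQ: "(A, Q) \<in> cells i" for A Q
    proof (cases "A = {}")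
      \<comment> \<open>The row of \<open>({}, {})\<close> reads cells with nonempty T; the support
        of \<open>y\<close> has none, and a cone over a leaf creates none.\<close>
      case True
      have "cone p y ({t}, {t, q}) = 0" if "t \<in> {1..n}" for t q
      proof -
        have "y ({t}, {t, q} - {p}) = 0"
        proof (rule ccontr)
          assume "y ({t}, {t, q} - {p}) \<noteq> 0"
          then have "{t, q} - {p} \<subseteq> leaves" by (rule supp(2))
          moreover have "t \<in> {t, q} - {p}" using that p_notin by auto
          ultimately show False using that by auto
        qed
        then show ?thesis by (simp add: cone_def)
      qed
      then have "boundary (cone p y) ({}, {}) = 0"
        by (simp add: boundary_def)
      moreover have "Q = {}" using AQ True by (simp add: cells_iff)
      ultimately show ?thesis
        using True supp(1)[of "{}" "{}"] \<open>A0 \<noteq> {}\<close> by auto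
    next
      case False
      have fQ: "finite Q" by (rule cells_finite[OF AQ])
      have "koszul y (A, Q - {p}) = 0" if pQ: "p \<in> Q"
      proof (cases "(Q - {p}) \<inter> leaves = {}")
        case False
        then show ?thesis by (rule cycle_koszul[OF y(2) AQ \<open>A \<noteq> {}\<close> pQ])
      next
        \<comment> \<open>Without \<open>p\<close> no leaf is left, so there is no cell at which to
          evaluate the cycle condition. Only degree 0 is possible, where the augmentation gives the
          sum of the coefficients over all leaves.\<close>
        case True
        show ?thesis
        proof (rule ccontr)
          assume nz: "koszul y (A, Q - {p}) \<noteq> 0"
          have A: "A = A0" and Q: "Q = {p}"
          proof -
            have "A = A0 \<and> Q - {p} \<subseteq> leaves"
              using nz
            proof (cases rule: koszul_neq_0)
              case (1 x)
              then show ?thesis using supp(1,2)[OF 1(2)] by blast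
            next
              case (2 x)
              then show ?thesis using supp(2)[OF 2(3)] by auto
            qed
            then show "A = A0" "Q = {p}" using True pQ by auto
          qed
          then have i: "i = 0" using AQ \<open>A \<noteq> {}\<close> by (simp add: cells_iff)
          have "koszul y (A0, {}) = (\<Sum>x\<in>leaves. y (A0, {x}))"
          proof -
            have "koszul y (A0, {}) = (\<Sum>x\<in>{1..n+s}. if x \<in> leaves then y (A0, {x}) else 0)"
              unfolding koszul_def prod.case
            proof (intro sum.cong)
              fix x assume "x \<in> {1..n+s}"
              show "eps x {} * face_diff x y A0 {x} = (if x \<in> leaves then y (A0, {x}) else 0)"
              proof (cases "x \<in> leaves")
                case True
                then show ?thesis by (simp add: face_diff_def eps_empty)
              next
                case False
                then have "y (B, {x}) = 0" for B
                  using supp(2)[of B "{x}"] by blast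
                then show ?thesis using False by (simp add: face_diff_def)
              qed
            qed simp
            also have "\<dots> = (\<Sum>x\<in>leaves. y (A0, {x}))"
              by (subst sum.inter_restrict[symmetric]) (auto intro: sum.cong)
            finally show ?thesis .
          qed
          also have "\<dots> = (\<Sum>q\<in>leaves. \<Sum>B\<in>Pow {1..n} - {{}}. y (B, {q}))"
          proof (intro sum.cong refl)
            fix q
            have "(\<Sum>B\<in>Pow {1..n} - {{}}. y (B, {q})) = (\<Sum>B\<in>{A0}. y (B, {q}))"
              using \<open>A0 \<noteq> {}\<close> supp(1) by (intro sum.mono_neutral_right) (auto simp: A0_def)
            then show "y (A0, {q}) = (\<Sum>B\<in>Pow {1..n} - {{}}. y (B, {q}))"
              by simp
          qed
          also have "\<dots> = (\<Sum>b\<in>cells 0. y b)"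
            using supp(1)[of "{}" "{}"] \<open>A0 \<noteq> {}\<close> by (auto simp: sum_cells_0)
          also have "\<dots> = 0"
            using y(2) by (simp add: cycle_def i boundary_def)
          finally show False using nz by (simp add: A Q)
        qed
      qed
      then have "cone p (koszul y) (A, Q) = 0"
        by (simp add: cone_def)
      then have "koszul (cone p y) (A, Q) = face_diff p y A Q"
        using koszul_cone[OF fQ p_notin(2), of y A] by simp
      then show ?thesis using False p(2) by (simp add: boundary_koszul face_diff_def)
    qed
    ultimately show ?thesis by (intro exI[of _ "cone p y"]) auto
  qed
  then obtain v where v: "supp_on (Suc i) M v" "\<forall>a\<in>cells i. y a = boundary v a"
    by blast
  have "supp_on (Suc i) M (\<lambda>b. w b + v b)"
    using w(1) v(1) by (rule supp_on_add)
  moreover have "z a = boundary (\<lambda>b. w b + v b) a" if "a \<in> cells i" for a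
    using v(2)[THEN bspec, OF that] that by (simp add: boundary_add y_def cell_boundary_def algebra_simps)
  ultimately show ?thesis by blast
qed

end

section \<open>Betti numbers and regularity\<close>

definition sqf :: "'v set \<Rightarrow> ('v \<Rightarrow>\<^sub>0 nat)" where
  "sqf S = (\<Sum>v\<in>S. Poly_Mapping.single v 1)"

lemma lookup_sqf: "finite S \<Longrightarrow> Poly_Mapping.lookup (sqf S) v = (if v \<in> S then 1 else 0)"
  by (simp add: sqf_def lookup_sum lookup_single when_def)

lemma keys_sqf: "finite S \<Longrightarrow> Poly_Mapping.keys (sqf S) = S"
  by (auto simp: in_keys_iff lookup_sqf split: if_splits)

lemma mon_deg_sqf: "finite S \<Longrightarrow> mon_deg (sqf S) = card S"
  by (simp add: mon_deg_def keys_sqf lookup_sqf)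

lemma mdvd_sqf_iff:
  assumes "finite S"
  shows "mdvd (sqf S) m \<longleftrightarrow> S \<subseteq> Poly_Mapping.keys m"
proof
  assume "mdvd (sqf S) m"
  then show "S \<subseteq> Poly_Mapping.keys m"
    using assms by (auto simp: mdvd_def keys_add_nat keys_sqf)
next
  assume S: "S \<subseteq> Poly_Mapping.keys m"
  have "m = sqf S + (m - sqf S)"
  proof (rule poly_mapping_eqI)
    fix v
    show "Poly_Mapping.lookup m v = Poly_Mapping.lookup (sqf S + (m - sqf S)) v"
      using S assms by (auto simp: lookup_add lookup_minus lookup_sqf in_keys_iff)
  qed
  then show "mdvd (sqf S) m" unfolding mdvd_def ..
qed

section \<open>The star complex as a labelled complex\<close>

context star
begin

text \<open>\<open>root\<close> is set apart because \<open>label_vars root\<close> consists of all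
  centre variables, whereas the generator of the ring has degree 0.\<close>

definition label :: "cell \<Rightarrow> (nat \<times> nat \<Rightarrow>\<^sub>0 nat)" where
  "label b = (if b = root then 0 else sqf (label_vars b))"

lemma label_cells: "b \<in> cells i \<Longrightarrow> label b = sqf (label_vars b)"
  by (auto simp: label_def cells_iff)

lemma label_vars_subset: "b \<in> cells i \<Longrightarrow> label_vars b \<subseteq> {1..n} \<times> {1..s+1}"
  by (cases b) (auto simp: label_vars_def cells_iff)

lemma finite_label_vars: "b \<in> cells i \<Longrightarrow> finite (label_vars b)"
  by (rule finite_subset[OF label_vars_subset]) simp_all

lemma cells_0_cases:
  assumes "b \<in> cells 0"
  obtains "b = ({}, {})" | A q where "b = (A, {q})" "A \<subseteq> {1..n}" "A \<noteq> {}" "q \<in> leaves"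
proof -
  obtain A Q where b: "b = (A, Q)" by (cases b)
  show thesis
  proof (cases "A = {}")
    case True
    then show thesis using assms b that(1) by (simp add: cells_iff)
  next
    case False
    then have "A \<subseteq> {1..n}" "Q \<inter> leaves \<noteq> {}" "card Q = Suc 0" using assms b by (auto simp: cells_iff)
    moreover from this obtain q where "Q = {q}" by (auto simp: card_Suc_eq)
    ultimately show thesis using that(2)[of A q] b False by simp
  qed
qed

text \<open>The variables of leaves reveal both components: their first indices form
  \<open>A\<close>, their second index is the leaf.\<close>

lemma inj_on_label_vars: "inj_on label_vars (cells 0)"
proof (rule inj_on_inverseI)
  fix b assume "b \<in> cells 0"
  then show "(\<lambda>X. ({i. \<exists>j. j \<le> s \<and> (i, j) \<in> X}, {n + j |i j. j \<le> s \<and> (i, j) \<in> X})) (label_vars b) = b"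
  proof (cases rule: cells_0_cases)
    case (2 A q)
    then obtain j where "q = n + j" "1 \<le> j" "j \<le> s" 
      by (metis add.commute atLeastAtMost_iff le_add_diff_inverse2 nat_add_left_cancel_le le_trans le_add1)
    then show ?thesis using 2 by (auto simp: mem_label_vars)
  qed (auto simp: mem_label_vars)
qed

lemma coef_label:
  assumes a: "a \<in> cells i" and b: "b \<in> cells (Suc i)" and nz: "coef a b \<noteq> (0 :: 'k::field)"
  shows "label_vars a \<subset> label_vars b"
proof -
  have "\<exists>b'. (if b' = b then 1 else 0 :: 'k) \<noteq> 0 \<and> label_vars a \<subset> label_vars b'"
    using b nz by (intro boundary_label[OF _ a]) (auto simp: coef_def split: if_splits)
  then show ?thesis by (auto split: if_splits)
qed

lemma finite_base: "finite (base i)"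
  by (cases i) (simp_all add: finite_cells)

sublocale labelled_cplx "{1..n} \<times> {1..s+1}" base label "coef :: cell \<Rightarrow> cell \<Rightarrow> 'k::field" root
proof
  show "finite (base i)" for i by (rule finite_base)
  show "base 0 = {root}" by simp
  show "label root = 0" by (simp add: label_def)
  show "coef root b = (1 :: 'k)" if "b \<in> base (Suc 0)" for b
    using that by (simp add: coef_def boundary_def finite_cells)
  show "Poly_Mapping.keys (label b) \<subseteq> {1..n} \<times> {1..s+1}" if "b \<in> base i" for b i
    using that label_vars_subset[of b] finite_label_vars[of b]
    by (cases i) (simp_all add: label_def keys_sqf)
  show "inj_on label (base (Suc 0))"
  proof (rule inj_onI)
    fix a b assume ab: "a \<in> base (Suc 0)" "b \<in> base (Suc 0)" "label a = label b"
    then have "Poly_Mapping.keys (sqf (label_vars a)) = Poly_Mapping.keys (sqf (label_vars b))"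
      using label_cells[of a 0] label_cells[of b 0] by simp
    then show "a = b"
      using ab inj_on_label_vars finite_label_vars[of a 0] finite_label_vars[of b 0] by (auto simp: keys_sqf dest: inj_onD)
  qed
  show "mdvd (label a) (label b)" if "a \<in> base i" "b \<in> base (Suc i)" "coef a b \<noteq> (0 :: 'k)" for a b i
  proof (cases i)
    case 0
    then show ?thesis using that(1) by (simp add: label_def mdvd_def)
  next
    case (Suc j)
    then have ab: "a \<in> cells j" "b \<in> cells (Suc j)" using that by simp_all
    show ?thesis
      using coef_label[OF ab that(3)] finite_label_vars[OF ab(1)] finite_label_vars[OF ab(2)]
      by (auto simp: label_cells[OF ab(1)] label_cells[OF ab(2)] mdvd_sqf_iff keys_sqf)
  qed
  show "label a \<noteq> label b"
    if "a \<in> base (Suc i)" "b \<in> base (Suc (Suc i))" "coef a b \<noteq> (0 :: 'k)" for a b i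
  proof
    have ab: "a \<in> cells i" "b \<in> cells (Suc i)" using that by simp_all
    assume "label a = label b"
    then have "Poly_Mapping.keys (sqf (label_vars a)) = Poly_Mapping.keys (sqf (label_vars b))"
      by (simp add: label_cells[OF ab(1)] label_cells[OF ab(2)])
    then show False
      using coef_label[OF ab that(3)] by (simp add: keys_sqf finite_label_vars[OF ab(1)] finite_label_vars[OF ab(2)])
  qed
  show "(\<Sum>x\<in>base (Suc i). coef a x * coef x b) = (0 :: 'k)"
    if "a \<in> base i" "b \<in> base (Suc (Suc i))" for a b i
  proof -
    let ?z = "\<lambda>b'. if b' = b then 1 else 0 :: 'k"
    have z: "b' \<in> cells (Suc i)" if "?z b' \<noteq> 0" for b'
      using that \<open>b \<in> base (Suc (Suc i))\<close> by (simp split: if_splits)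
    have "(\<Sum>x\<in>base (Suc i). coef a x * coef x b) = (\<Sum>x\<in>cells i. coef a x * cell_boundary i ?z x)"
      by (intro sum.cong) (simp_all add: cell_boundary_def coef_def)
    also have "\<dots> = boundary (cell_boundary i ?z) a"
      by (rule boundary_coef[OF finite_cells]) (simp add: cell_boundary_def split: if_splits)
    also have "\<dots> = 0"
      using z \<open>a \<in> base i\<close> by (rule boundary_cell_boundary)
    finally show ?thesis .
  qed
  show "\<exists>w. (\<forall>b. w b \<noteq> 0 \<longrightarrow> b \<in> base (Suc (Suc i)) \<and> mdvd (label b) m) \<and>
      (\<forall>a\<in>base (Suc i). z a = (\<Sum>b\<in>base (Suc (Suc i)). coef a b * w b))"
    if z: "\<And>b. z b \<noteq> 0 \<Longrightarrow> b \<in> base (Suc i) \<and> mdvd (label b) m"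
      and cyc: "\<And>a. a \<in> base i \<Longrightarrow> (\<Sum>b\<in>base (Suc i). coef a b * z b) = 0"
    for z :: "cell \<Rightarrow> 'k" and i m
  proof -
    \<comment> \<open>Squarefree labels see only the support of \<open>m\<close>, so
      \<open>acyclic_cells\<close> for sets of variables covers all exponent vectors.\<close>
    have label_iff: "mdvd (label b) m \<longleftrightarrow> label_vars b \<subseteq> Poly_Mapping.keys m" if "b \<in> cells j" for b j
      by (simp add: label_cells[OF that] mdvd_sqf_iff[OF finite_label_vars[OF that]])
    have "supp_on i (Poly_Mapping.keys m) z"
      unfolding supp_on_def
    proof (intro allI impI)
      fix b assume "z b \<noteq> 0"
      then show "b \<in> cells i \<and> label_vars b \<subseteq> Poly_Mapping.keys m"
        using z[of b] label_iff[of b i] by simp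
    qed
    moreover have "cycle i z"
      unfolding cycle_def
    proof
      fix a assume "a \<in> base i"
      from cyc[OF this] show "boundary z a = 0"
        using boundary_coef[OF finite_cells[of i], of z a] z by simp
    qed
    ultimately obtain w where w: "supp_on (Suc i) (Poly_Mapping.keys m) w" "\<forall>a\<in>cells i. z a = boundary w a"
      using acyclic_cells by blast
    have "w b \<noteq> 0 \<longrightarrow> b \<in> base (Suc (Suc i)) \<and> mdvd (label b) m" for b
    proof
      assume "w b \<noteq> 0"
      then have "b \<in> cells (Suc i) \<and> label_vars b \<subseteq> Poly_Mapping.keys m"
        using w(1) unfolding supp_on_def by blast
      then show "b \<in> base (Suc (Suc i)) \<and> mdvd (label b) m"
        using label_iff[of b "Suc i"] by simp
    qed
    moreover have "z a = (\<Sum>b\<in>base (Suc (Suc i)). coef a b * w b)" if "a \<in> base (Suc i)" for a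
    proof -
      have "(\<Sum>b\<in>cells (Suc i). coef a b * w b) = boundary w a"
        by (rule boundary_coef[OF finite_cells]) (rule supp_onD[OF w(1)])
      then show ?thesis using that w(2) by simp
    qed
    ultimately show ?thesis by blast
  qed
qed

end

text \<open>Applying the comparison in both directions shows that the chosen resolution has the same
  shifts as the known one.\<close>

lemma betti_iff:
  assumes G: "minimal_graded_free_resolution V I G"
  shows "betti V I i j \<noteq> 0 \<longleftrightarrow> j \<in> fshift G i ` {..<frank G i}"
proof -
  define F where "F = (SOME F. minimal_graded_free_resolution V I F)"
  have F: "minimal_graded_free_resolution V I F"
    unfolding F_def using G by (rule someI)
  have FR: "graded_free_resolution V I F" and GR: "graded_free_resolution V I G"
    using F G by (simp_all add: minimal_graded_free_resolution_def)
  have "betti V I i j = card {k. k < frank F i \<and> fshift F i k = j}"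
    unfolding betti_def F_def Let_def ..
  then have "betti V I i j \<noteq> 0 \<longleftrightarrow> (\<exists>k<frank F i. fshift F i k = j)"
    by auto
  also have "\<dots> \<longleftrightarrow> (\<exists>k<frank G i. fshift G i k = j)"
    using minimal_resolution_shift[OF F GR, of _ i] minimal_resolution_shift[OF G FR, of _ i] by metis
  also have "\<dots> \<longleftrightarrow> j \<in> fshift G i ` {..<frank G i}"
    by auto
  finally show ?thesis .
qed

lemma prod_single:
  "finite X \<Longrightarrow> (\<Prod>i\<in>X. Poly_Mapping.single (f i) (1 :: 'k::field)) =
    Poly_Mapping.single (\<Sum>i\<in>X. f i :: 'v \<Rightarrow>\<^sub>0 nat) 1"
  by (induction X rule: finite_induct) (simp_all add: mult_single)

lemma whom_monomial_eq:
  "whom_monomial G \<phi> = Poly_Mapping.single (sqf ((\<lambda>i. (i, \<phi> i)) ` verts G)) (1 :: 'k::field)"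
proof -
  have "whom_monomial G \<phi> = (\<Prod>i\<in>verts G. Poly_Mapping.single (Poly_Mapping.single (i, \<phi> i) 1) (1 :: 'k))"
    by (simp add: whom_monomial_def pvar_def)
  also have "\<dots> = Poly_Mapping.single (\<Sum>i\<in>verts G. Poly_Mapping.single (i, \<phi> i) 1) 1"
    by (rule prod_single) simp
  also have "(\<Sum>i\<in>verts G. Poly_Mapping.single (i, \<phi> i) (1::nat)) = sqf ((\<lambda>i. (i, \<phi> i)) ` verts G)"
    unfolding sqf_def by (subst sum.reindex) (auto simp: inj_on_def)
  finally show ?thesis .
qed

context star
begin

section \<open>Degrees of cells and identification of the generators\<close>

lemma card_label_vars:
  assumes "(A, Q) \<in> cells i" "A \<noteq> {}"
  obtains a p t where "card (label_vars (A, Q)) = a * p + (n - (a - t))" "t + p = Suc i"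
    "1 \<le> a" "a \<le> n" "1 \<le> p" "p \<le> s" "t \<le> a"
proof -
  define P where "P = {j \<in> {1..s}. n + j \<in> Q}"
  have A: "A \<subseteq> {1..n}" "Q \<subseteq> A \<union> leaves" "Q \<inter> leaves \<noteq> {}" "card Q = Suc i"
    using assms by (auto simp: cells_iff)
  have fin: "finite A" "finite Q" "finite P"
    using A(1) cells_finite[OF assms(1)] finite_subset by (auto simp: P_def)
  have leaves: "Q \<inter> leaves = (+) n ` P"
  proof (intro subset_antisym subsetI)
    fix q assume q: "q \<in> Q \<inter> leaves"
    then show "q \<in> (+) n ` P"
      by (intro image_eqI[of _ _ "q - n"]) (auto simp: P_def)
  qed (auto simp: P_def)
  have "Q = (A \<inter> Q) \<union> (Q \<inter> leaves)" "(A \<inter> Q) \<inter> (Q \<inter> leaves) = {}"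
    using A(1,2) by auto
  then have "card Q = card (A \<inter> Q) + card (Q \<inter> leaves)"
    using fin card_Un_disjoint[of "A \<inter> Q" "Q \<inter> leaves"] by simp
  also have "card (Q \<inter> leaves) = card P"
    unfolding leaves by (simp add: card_image)
  finally have Q: "card (A \<inter> Q) + card P = Suc i" using A(4) by simp
  have "card (A - Q) = card A - card (A \<inter> Q)"
    using fin by (simp add: card_Diff_subset_Int)
  then have "card ({1..n} - (A - Q)) = n - (card A - card (A \<inter> Q))"
    using A(1) fin by (subst card_Diff_subset) auto
  moreover have "label_vars (A, Q) = A \<times> P \<union> ({1..n} - (A - Q)) \<times> {s + 1}"
    by (simp add: label_vars_def P_def)
  moreover have "(A \<times> P) \<inter> (({1..n} - (A - Q)) \<times> {s + 1}) = {}"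
    by (auto simp: P_def)
  ultimately have "card (label_vars (A, Q)) = card A * card P + (n - (card A - card (A \<inter> Q)))"
    using fin by (simp add: card_Un_disjoint card_cartesian_product)
  moreover have "card A \<le> n"
    using card_mono[OF _ A(1)] by simp
  moreover have "card P \<le> s"
  proof -
    have "P \<subseteq> {1..s}" by (auto simp: P_def)
    from card_mono[OF _ this] show ?thesis by simp
  qed
  moreover have "1 \<le> card A"
    using fin assms(2) by (simp add: Suc_le_eq card_gt_0_iff)
  moreover have "1 \<le> card P"
    using fin A(3) leaves by (simp add: Suc_le_eq card_gt_0_iff)
  moreover have "card (A \<inter> Q) \<le> card A"
    using fin by (intro card_mono) auto
  ultimately show thesis using that[of "card A" "card P" "card (A \<inter> Q)"] Q by blast
qed

text \<open>The size of T enters degree and homological degree equally and cancels. What remains is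
  monotonicity of the product (a - 1)(p - 1); for the cell with empty \<open>A\<close> it is the
  inequality 0 <= (n - 1)(s - 1).\<close>

lemma card_label_vars_bound:
  assumes b: "b \<in> cells i" and ns: "1 \<le> n" "1 \<le> s"
  shows "int (card (label_vars b)) - int i \<le> int s * int n - int s + 1"
proof -
  obtain A Q where AQ: "b = (A, Q)" by (cases b)
  show ?thesis
  proof (cases "A = {}")
    case True
    then have "label_vars b = {1..n} \<times> {s + 1}" "i = 0"
      using b by (auto simp: AQ cells_iff label_vars_def)
    moreover have "0 \<le> (int n - 1) * (int s - 1)"
      using ns by simp
    ultimately show ?thesis by (simp add: card_cartesian_product algebra_simps)
  next
    case False
    then obtain a p t where *: "card (label_vars b) = a * p + (n - (a - t))" "t + p = Suc i"
      "1 \<le> a" "a \<le> n" "1 \<le> p" "p \<le> s" "t \<le> a"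
      using card_label_vars b unfolding AQ by metis
    have "int (card (label_vars b)) = int a * int p + (int n - (int a - int t))"
      using * by (simp add: of_nat_diff)
    moreover have "(int a - 1) * (int p - 1) \<le> (int n - 1) * (int s - 1)"
      using * by (intro mult_mono) auto
    moreover have "int i = int t + int p - 1" using *(2) by simp
    ultimately show ?thesis by (simp add: algebra_simps)
  qed
qed

text \<open>The cell with all vertices, all leaves and T = A attains the bound.\<close>

lemma top_cell:
  assumes ns: "1 \<le> n" "1 \<le> s"
  shows "({1..n}, {1..n+s}) \<in> cells (n + s - 1)"
    "card (label_vars ({1..n}, {1..n+s})) = n * s + n"
proof -
  show "({1..n}, {1..n+s}) \<in> cells (n + s - 1)"
    using ns by (auto simp: cells_iff)
  have "label_vars ({1..n}, {1..n+s}) = {1..n} \<times> {1..s+1}"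
    by (auto simp: label_vars_def)
  then show "card (label_vars ({1..n}, {1..n+s})) = n * s + n"
    by (simp add: card_cartesian_product)
qed

text \<open>Any two vertices of the complete graph are adjacent and distinct leaves are not, so all
  vertices not sent to the centre go to one common leaf. This is the data \<open>(A, {q})\<close> of
  a cell in degree 0.\<close>

lemma whom_graphs:
  "(\<lambda>\<phi>. (\<lambda>i. (i, \<phi> i)) ` {1..n}) ` WHom (complete_graph n) (star_graph s) = label_vars ` cells 0"
proof (intro subset_antisym subsetI)
  fix X assume "X \<in> (\<lambda>\<phi>. (\<lambda>i. (i, \<phi> i)) ` {1..n}) ` WHom (complete_graph n) (star_graph s)"
  then obtain \<phi> where \<phi>: "\<phi> \<in> WHom (complete_graph n) (star_graph s)" "X = (\<lambda>i. (i, \<phi> i)) ` {1..n}"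
    by blast
  have range: "1 \<le> \<phi> i \<and> \<phi> i \<le> s + 1" if "i \<in> {1..n}" for i
    using \<phi>(1) that by (auto simp: WHom_def complete_graph_def star_graph_def)
  have adj: "\<phi> x = \<phi> y \<or> \<phi> x = s + 1 \<or> \<phi> y = s + 1" if "x \<in> {1..n}" "y \<in> {1..n}" "x \<noteq> y" for x y
  proof -
    have "{x, y} \<in> edges (complete_graph n)"
      using that by (auto simp: complete_graph_def)
    then have "\<phi> x = \<phi> y \<or> {\<phi> x, \<phi> y} \<in> edges (star_graph s)"
      using \<phi>(1) by (auto simp: WHom_def)
    then show ?thesis by (auto simp: star_graph_def doubleton_eq_iff)
  qed
  define A where "A = {i \<in> {1..n}. \<phi> i \<noteq> s + 1}"
  show "X \<in> label_vars ` cells 0"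
  proof (cases "A = {}")
    case True
    then have "X = label_vars ({}, {})"
      using \<phi>(2) by (auto simp: A_def label_vars_def)
    moreover have "({}, {}) \<in> cells 0" by (simp add: cells_iff)
    ultimately show ?thesis by blast
  next
    case False
    then obtain i where i: "i \<in> A" by blast
    define j where "j = \<phi> i"
    have j: "1 \<le> j" "j \<le> s" using range[of i] i by (auto simp: A_def j_def)
    have const: "\<phi> x = j" if "x \<in> A" for x
      using adj[of x i] that i by (auto simp: A_def j_def)
    have "(A, {n + j}) \<in> cells 0"
      using j i by (auto simp: cells_iff A_def)
    moreover have "X = label_vars (A, {n + j})"
    proof (intro subset_antisym subsetI)
      fix v assume "v \<in> X"
      then obtain x where "x \<in> {1..n}" "v = (x, \<phi> x)" using \<phi>(2) by blast
      then show "v \<in> label_vars (A, {n + j})"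
        using const[of x] j by (cases "x \<in> A") (auto simp: mem_label_vars A_def)
    next
      fix v assume v: "v \<in> label_vars (A, {n + j})"
      obtain x k where "v = (x, k)" by (cases v)
      then have "x \<in> {1..n} \<and> k = \<phi> x"
        using v const[of x] j by (auto simp: mem_label_vars A_def)
      then show "v \<in> X" using \<phi>(2) \<open>v = (x, k)\<close> by blast
    qed
    ultimately show ?thesis by blast
  qed
next
  fix X assume "X \<in> label_vars ` cells 0"
  then obtain b where b: "b \<in> cells 0" "X = label_vars b" by blast
  then have "\<exists>A j. A \<subseteq> {1..n} \<and> (A \<noteq> {} \<longrightarrow> 1 \<le> j \<and> j \<le> s) \<and>
      X = (\<lambda>i. (i, if i \<in> A then j else s + 1)) ` {1..n}"
  proof (cases rule: cells_0_cases)
    case 1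
    then show ?thesis using b(2) by (intro exI[of _ "{}"]) (auto simp: label_vars_def)
  next
    case (2 A q)
    define j where "j = q - n"
    have j: "q = n + j" "1 \<le> j" "j \<le> s" using 2(4) by (auto simp: j_def)
    have "X = (\<lambda>i. (i, if i \<in> A then j else s + 1)) ` {1..n}"
    proof (rule set_eqI)
      fix v :: "nat \<times> nat"
      obtain x k where v: "v = (x, k)" by (cases v)
      show "v \<in> X \<longleftrightarrow> v \<in> (\<lambda>i. (i, if i \<in> A then j else s + 1)) ` {1..n}"
        using 2(1,2) j by (cases "x \<in> A") (auto simp: v b(2) mem_label_vars image_iff)
    qed
    then show ?thesis using 2(2) j by blast
  qed
  then obtain A j where A: "A \<subseteq> {1..n}" "A \<noteq> {} \<longrightarrow> 1 \<le> j \<and> j \<le> s"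
    "X = (\<lambda>i. (i, if i \<in> A then j else s + 1)) ` {1..n}" by blast
  define \<phi> where "\<phi> = (\<lambda>i\<in>{1..n}. if i \<in> A then j else s + 1)"
  have "\<phi> \<in> WHom (complete_graph n) (star_graph s)"
    using A(1,2) by (auto simp: WHom_def complete_graph_def star_graph_def \<phi>_def doubleton_eq_iff)
  moreover have "X = (\<lambda>i. (i, \<phi> i)) ` {1..n}"
    unfolding A(3) \<phi>_def by (intro image_cong) auto
  ultimately show "X \<in> (\<lambda>\<phi>. (\<lambda>i. (i, \<phi> i)) ` {1..n}) ` WHom (complete_graph n) (star_graph s)"
    by blast
qed

lemma whom_generators:
  "whom_monomial (complete_graph n) ` WHom (complete_graph n) (star_graph s) =
    (\<lambda>b. Poly_Mapping.single (label b) (1 :: 'k::field)) ` base (Suc 0)"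
proof -
  have verts: "verts (complete_graph n) = {1..n}"
    by (simp add: complete_graph_def)
  have "whom_monomial (complete_graph n) ` WHom (complete_graph n) (star_graph s) =
      (\<lambda>X. Poly_Mapping.single (sqf X) (1 :: 'k)) `
        (\<lambda>\<phi>. (\<lambda>i. (i, \<phi> i)) ` {1..n}) ` WHom (complete_graph n) (star_graph s)"
    unfolding image_image whom_monomial_eq verts ..
  also have "\<dots> = (\<lambda>b. Poly_Mapping.single (label b) (1 :: 'k)) ` base (Suc 0)"
    unfolding whom_graphs image_image by (intro image_cong) (simp_all add: label_cells)
  finally show ?thesis .
qed

lemma betti_whom_ideal_iff:
  "betti (whom_vars (complete_graph n) (star_graph s))
      (whom_ideal (complete_graph n) (star_graph s) :: (nat \<times> nat, 'k::field) mpoly set) i j \<noteq> 0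
    \<longleftrightarrow> j \<in> (\<lambda>b. card (label_vars b)) ` cells i"
proof -
  have vars: "whom_vars (complete_graph n) (star_graph s) = {1..n} \<times> {1..s+1}"
    by (simp add: complete_graph_def star_graph_def)
  have "minimal_graded_free_resolution (whom_vars (complete_graph n) (star_graph s))
      (whom_ideal (complete_graph n) (star_graph s)) (homogenization :: (nat \<times> nat, 'k) free_cplx)"
    unfolding whom_ideal_def vars whom_generators by (rule homogenization_minimal_resolution)
  from betti_iff[OF this, of i j]
  have "betti (whom_vars (complete_graph n) (star_graph s))
      (whom_ideal (complete_graph n) (star_graph s) :: (nat \<times> nat, 'k) mpoly set) i j \<noteq> 0
    \<longleftrightarrow> j \<in> (\<lambda>b. mon_deg (label b)) ` base (Suc i)"
    unfolding shifts_homogenization .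
  also have "(\<lambda>b. mon_deg (label b)) ` base (Suc i) = (\<lambda>b. card (label_vars b)) ` cells i"
    by (intro image_cong) (simp_all add: label_cells mon_deg_sqf finite_label_vars)
  finally show ?thesis .
qed

end

theorem corollary2p14:
  fixes s n :: nat
  assumes "s \<ge> 1" and "n \<ge> 1"
  shows "reg (whom_vars (complete_graph n) (star_graph s))
           (whom_ideal (complete_graph n) (star_graph s) :: (nat \<times> nat, 'k::field) mpoly set)
         = int s * int n - int s + 1"
  unfolding reg_def star.betti_whom_ideal_iff
proof (rule Greatest_equality)
  have "int s * int n - int s + 1 = int (n * s + n) - int (n + s - 1)"
    using assms by (simp add: of_nat_diff algebra_simps)
  then show "\<exists>i j. j \<in> (\<lambda>b. card (star.label_vars n s b)) ` star.cells n s i \<and>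
      int s * int n - int s + 1 = int j - int i"
    using star.top_cell[OF assms(2,1)] by (metis imageI)
  show "d \<le> int s * int n - int s + 1"
    if "\<exists>i j. j \<in> (\<lambda>b. card (star.label_vars n s b)) ` star.cells n s i \<and> d = int j - int i" for d
    using that star.card_label_vars_bound[OF _ assms(2,1)] by auto
qed

end
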